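(* The circuit equivalence problem for $\mathrm{CC}[2,3,2]$-circuits can be polytime-reduced to the following problem: given $k,n\in\mathbb{N}$ and expanded polynomials $p_1,\dots,p_k\in\mathbb{Z}_3[x_1,\dots,x_n]$, decide whether $\sum_{i=1}^k\alpha^{p_i(\mathbf{a})}=0$ for all $\mathbf{a}\in\{-1,1\}^n$.
   Context: $\alpha$ is a primitive element of the field $\mathbb{F}_4$; since $\alpha^3=1$, $\alpha^t$ is defined for $t\in\mathbb{Z}_3$; $p_i(\mathbf{a})$ is computed in $\mathbb{Z}_3$ and the sum in $\mathbb{F}_4$. An expanded polynomial is given as $\sum_{\mathbf{e}\in I}c_{\mathbf{e}}x_1^{e_1}\cdots x_n^{e_n}$ with $I\subseteq\{0,1,2\}^n$ and $c_{\mathbf{e}}\in\mathbb{Z}_3\setminus\{0\}$. A $\mathrm{CC}[2,3,2]$-circuit on inputs $y_1,\dots,y_n\in\{0,1\}$ is a depth-3 circuit with unbounded fan-in $\mathrm{MOD}_2$, $\mathrm{MOD}_3$, $\mathrm{MOD}_2$ gates at depths $1,2,3$ (a $\mathrm{MOD}_m$ gate outputs $1$ iff the sum of its inputs, with multiplicity, is divisible by $m$, else $0$), some input wires possibly constant $1$; equivalently an expression $\mathrm{Mod}_2\big(c_0+\sum_{i=1}^k\mathrm{Mod}_3\big(c_1(i)+\sum_{j=1}^{l(i)}\mathrm{Mod}_2(c_2(i,j)+\sum_{m=1}^n e(i,j,m)y_m)\big)\big)$ with nonnegative integer constants, $\mathrm{Mod}_r(z)=1$ iff $r\mid z$. Its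 size is the number of gates. The circuit equivalence problem asks, given such a circuit $C$, whether $C$ evaluates to $1$ on every input vector. Polytime-reducible: there is a polynomial-time transformation $P$ of inputs with $A(e)\iff B(P(e))$. *)

theory Defs
  imports "HOL-Computational_Algebra.Polynomial"
begin

text \<open>
  Deterministic multi-tape Turing machines with two-way infinite tapes. Tape symbols are
  \<open>0, \<dots>, num_syms - 1\<close>, where \<open>0\<close> is the blank; states are \<open>0, \<dots>, halt_state\<close>, where \<open>0\<close> is the
  start state. The transition table maps a state and the list of scanned symbols (one per tape)
  to the next state, the symbols written, and the head moves. By \<open>wf_tm\<close> only a finite part of
  it matters.
\<close>

record tm =
  num_tapes :: nat
  num_syms :: nat
  halt_state :: nat
  delta :: "nat \<Rightarrow> nat list \<Rightarrow> nat \<times> nat list \<times> int list"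

definition wf_tm :: "tm \<Rightarrow> bool" where
  "wf_tm M \<longleftrightarrow> num_tapes M \<ge> 1 \<and> num_syms M \<ge> 1 \<and>
     (\<forall>q < halt_state M. \<forall>v. length v = num_tapes M \<and> set v \<subseteq> {..<num_syms M} \<longrightarrow>
        (case delta M q v of (q', w, d) \<Rightarrow>
           q' \<le> halt_state M \<and>
           length w = num_tapes M \<and> set w \<subseteq> {..<num_syms M} \<and>
           length d = num_tapes M \<and> set d \<subseteq> {-1, 0, 1}))"

text \<open>A tape is its head position together with its contents.\<close>

type_synonym tape = "int \<times> (int \<Rightarrow> nat)"
type_synonym config = "nat \<times> tape list"

definition scanned :: "tape \<Rightarrow> nat" where
  "scanned T = snd T (fst T)"

definition act :: "tape \<Rightarrow> nat \<Rightarrow> int \<Rightarrow> tape" where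
  "act T s d = (fst T + d, (snd T)(fst T := s))"

definition step :: "tm \<Rightarrow> config \<Rightarrow> config" where
  "step M = (\<lambda>(q, Ts).
     if q = halt_state M then (q, Ts)
     else (case delta M q (map scanned Ts) of (q', w, d) \<Rightarrow>
       (q', map (\<lambda>i. act (Ts ! i) (w ! i) (d ! i)) [0..<num_tapes M])))"

definition word_tape :: "nat list \<Rightarrow> tape" where
  "word_tape x = (0, \<lambda>z. if 0 \<le> z \<and> z < int (length x) then x ! nat z else 0)"

definition init :: "tm \<Rightarrow> nat list \<Rightarrow> config" where
  "init M x = (0, word_tape x # replicate (num_tapes M - 1) (word_tape []))"

text \<open>The word on a tape extends from the head position to the right, up to the first blank.\<close>

definition tape_word :: "tape \<Rightarrow> nat list \<Rightarrow> bool" where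
  "tape_word T y \<longleftrightarrow>
     (\<forall>j < length y. snd T (fst T + int j) = y ! j \<and> y ! j \<noteq> 0) \<and>
     snd T (fst T + int (length y)) = 0"

text \<open>
  Input is on the first tape, output on the last one. As a halted configuration is a fixed
  point of \<open>step\<close>, the following says that the machine halts within \<open>t\<close> steps.
\<close>

definition computes_within :: "tm \<Rightarrow> nat list \<Rightarrow> nat list \<Rightarrow> nat \<Rightarrow> bool" where
  "computes_within M x y t \<longleftrightarrow>
     set x \<subseteq> {1..<num_syms M} \<and>
     (case (step M ^^ t) (init M x) of (q, Ts) \<Rightarrow> q = halt_state M \<and> tape_word (last Ts) y)"

record 'a decision_problem =
  instances :: "'a set"
  encode :: "'a \<Rightarrow> nat list"
  holds :: "'a \<Rightarrow> bool"

definition polytime_transformation ::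
  "'a decision_problem \<Rightarrow> 'b decision_problem \<Rightarrow> ('a \<Rightarrow> 'b) \<Rightarrow> bool" where
  "polytime_transformation A B P \<longleftrightarrow>
     (\<forall>e \<in> instances A. P e \<in> instances B) \<and>
     (\<exists>M (b :: nat poly). wf_tm M \<and>
        (\<forall>e \<in> instances A.
           computes_within M (encode A e) (encode B (P e)) (poly b (length (encode A e)))))"

definition polytime_reducible :: "'a decision_problem \<Rightarrow> 'b decision_problem \<Rightarrow> bool" where
  "polytime_reducible A B \<longleftrightarrow>
     (\<exists>P. polytime_transformation A B P \<and> (\<forall>e \<in> instances A. holds A e \<longleftrightarrow> holds B (P e)))"

text \<open>
  Instances are written with the symbols \<open>1\<close>, \<open>2\<close> (binary digits zero and one), \<open>3\<close> (end of
  number), \<open>4\<close> and \<open>5\<close> (opening and closing bracket). Numbers are in binary, least significant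
  digit first.
\<close>

fun bits :: "nat \<Rightarrow> nat list" where
  "bits n = (if n = 0 then [] else (1 + n mod 2) # bits (n div 2))"

declare bits.simps [simp del]

definition enc_nat :: "nat \<Rightarrow> nat list" where
  "enc_nat n = bits n @ [3]"

definition enc_list :: "('a \<Rightarrow> nat list) \<Rightarrow> 'a list \<Rightarrow> nat list" where
  "enc_list f xs = [4] @ concat (map f xs) @ [5]"

text \<open>
  The circuit \<open>Circuit n c0 [\<dots>, Gate2 (c1 i) [\<dots>, Gate1 (c2 i j) [e i j 1, \<dots>, e i j n], \<dots>], \<dots>]\<close>
  on \<open>n\<close> inputs stands for
  \<open>Mod 2 (c0 + (\<Sum>i. Mod 3 (c1 i + (\<Sum>j. Mod 2 (c2 i j + (\<Sum>m. e i j m * y m))))))\<close>.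
  The additive constants count the wires that carry the constant \<open>1\<close>, and \<open>e i j m\<close> is the
  multiplicity of the wire from input \<open>m\<close>.
\<close>

datatype gate1 = Gate1 nat "nat list"
datatype gate2 = Gate2 nat "gate1 list"
datatype circuit = Circuit nat nat "gate2 list"

definition Mod :: "nat \<Rightarrow> nat \<Rightarrow> nat" where
  "Mod r z = (if r dvd z then 1 else 0)"

fun eval_gate1 :: "nat list \<Rightarrow> gate1 \<Rightarrow> nat" where
  "eval_gate1 y (Gate1 c es) = Mod 2 (c + (\<Sum>m<length es. es ! m * y ! m))"

fun eval_gate2 :: "nat list \<Rightarrow> gate2 \<Rightarrow> nat" where
  "eval_gate2 y (Gate2 c gs) = Mod 3 (c + (\<Sum>g\<leftarrow>gs. eval_gate1 y g))"

fun eval_circuit :: "nat list \<Rightarrow> circuit \<Rightarrow> nat" where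
  "eval_circuit y (Circuit n c gs) = Mod 2 (c + (\<Sum>g\<leftarrow>gs. eval_gate2 y g))"

fun num_inputs :: "circuit \<Rightarrow> nat" where
  "num_inputs (Circuit n c gs) = n"

fun wf_gate1 :: "nat \<Rightarrow> gate1 \<Rightarrow> bool" where
  "wf_gate1 n (Gate1 c es) \<longleftrightarrow> length es = n"

fun wf_gate2 :: "nat \<Rightarrow> gate2 \<Rightarrow> bool" where
  "wf_gate2 n (Gate2 c gs) \<longleftrightarrow> (\<forall>g \<in> set gs. wf_gate1 n g)"

fun wf_circuit :: "circuit \<Rightarrow> bool" where
  "wf_circuit (Circuit n c gs) \<longleftrightarrow> (\<forall>g \<in> set gs. wf_gate2 n g)"

fun enc_gate1 :: "gate1 \<Rightarrow> nat list" where
  "enc_gate1 (Gate1 c es) = enc_nat c @ enc_list enc_nat es"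

fun enc_gate2 :: "gate2 \<Rightarrow> nat list" where
  "enc_gate2 (Gate2 c gs) = enc_nat c @ enc_list enc_gate1 gs"

fun enc_circuit :: "circuit \<Rightarrow> nat list" where
  "enc_circuit (Circuit n c gs) = enc_nat n @ enc_nat c @ enc_list enc_gate2 gs"

definition cc232_equivalence :: "circuit decision_problem" where
  "cc232_equivalence =
     \<lparr> instances = {C. wf_circuit C},
       encode = enc_circuit,
       holds = (\<lambda>C. \<forall>y. length y = num_inputs C \<and> set y \<subseteq> {0, 1} \<longrightarrow> eval_circuit y C = 1) \<rparr>"

text \<open>
  An expanded polynomial over the integers modulo 3 is the list of its monomials, each given by
  its coefficient and exponent vector. The nonzero coefficients are represented by \<open>1\<close> and \<open>2\<close>.
\<close>

type_synonym expanded_poly = "(nat \<times> nat list) list"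

definition wf_expanded :: "nat \<Rightarrow> expanded_poly \<Rightarrow> bool" where
  "wf_expanded n p \<longleftrightarrow>
     distinct (map snd p) \<and>
     (\<forall>(c, es) \<in> set p. c \<in> {1, 2} \<and> length es = n \<and> set es \<subseteq> {0, 1, 2})"

definition eval_expanded :: "expanded_poly \<Rightarrow> int list \<Rightarrow> int" where
  "eval_expanded p a = (\<Sum>(c, es)\<leftarrow>p. int c * (\<Prod>m<length es. a ! m ^ (es ! m))) mod 3"

definition enc_monomial :: "nat \<times> nat list \<Rightarrow> nat list" where
  "enc_monomial = (\<lambda>(c, es). enc_nat c @ enc_list enc_nat es)"

definition enc_poly_system :: "nat \<times> expanded_poly list \<Rightarrow> nat list" where
  "enc_poly_system = (\<lambda>(n, ps). enc_nat n @ enc_list (enc_list enc_monomial) ps)"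

definition primitive_element :: "'f::field \<Rightarrow> bool" where
  "primitive_element \<alpha> \<longleftrightarrow> {\<alpha> ^ i |i :: nat. True} = UNIV - {0}"

text \<open>An instance \<open>(n, ps)\<close> consists of \<open>k = length ps\<close> polynomials in \<open>n\<close> variables.\<close>

definition poly_exp_sum_zero :: "'f::field \<Rightarrow> (nat \<times> expanded_poly list) decision_problem" where
  "poly_exp_sum_zero \<alpha> =
     \<lparr> instances = {(n, ps). \<forall>p \<in> set ps. wf_expanded n p},
       encode = enc_poly_system,
       holds = (\<lambda>(n, ps). \<forall>a. length a = n \<and> set a \<subseteq> {-1, 1} \<longrightarrow>
                  (\<Sum>p\<leftarrow>ps. \<alpha> ^ nat (eval_expanded p a)) = 0) \<rparr>"

end

theory Submission
  imports Defs "HOL-Number_Theory.Cong"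
begin

text \<open>
  Over the field with four elements, \<open>Mod 3 z = 1 + \<alpha>\<^sup>z + \<alpha>\<^bsup>2z\<^esup>\<close>, and the output gate is \<open>1\<close> iff
  \<open>c0\<close> plus the sum of its other inputs vanishes in characteristic \<open>2\<close>. Substituting \<open>a = (-1)\<^sup>y\<close>,
  a gate at depth 1 becomes \<open>2 + 2 * (-1)\<^sup>c * (\<Prod>m. a m ^ (e m mod 2))\<close> modulo 3, so
  the exponents \<open>z\<close> and \<open>2z\<close> are sums of monomials in \<open>a\<close>. Instead of collecting equal monomials,
  we multiply each one by squares of dummy variables, which are \<open>1\<close> on \<open>\<plusminus>1\<close> and encode
  a serial number. The numbers of ordinary and of dummy variables are both twice the length of the
  input; this keeps the output polynomial even if no gate refers to the variables and their number,
  which is given in binary, is exponential. The resulting transformation reads its input from left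
  to right, once for the exponents \<open>z\<close> and once for \<open>2z\<close>, and is programmed in a small language of
  while programs that is compiled to Turing machines.
\<close>

section \<open>Tapes as zippers\<close>

text \<open>
  The cells to the left of the head, nearest first, and those from the head on to the right;
  all cells beyond the two lists are blank.
\<close>

type_synonym zipper = "nat list \<times> nat list"

fun zscan :: "zipper \<Rightarrow> nat" where
  "zscan (l, r) = nth_default 0 r 0"

fun zact :: "zipper \<Rightarrow> nat \<Rightarrow> int \<Rightarrow> zipper" where
  "zact (l, r) s d =
     (if d = 1 then (s # l, tl r)
      else if d = -1 then (tl l, nth_default 0 l 0 # s # tl r)
      else (l, s # tl r))"

definition represents :: "tape \<Rightarrow> zipper \<Rightarrow> bool" where
  "represents T z \<longleftrightarrow>
     (\<forall>i. snd T (fst T + int i) = nth_default 0 (snd z) i) \<and>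
     (\<forall>i. snd T (fst T - 1 - int i) = nth_default 0 (fst z) i)"

lemma nth_default_tl: "nth_default d (tl xs) i = nth_default d xs (Suc i)"
  by (cases xs) simp_all

lemma scanned_represents: "represents T z \<Longrightarrow> scanned T = zscan z"
  unfolding represents_def scanned_def
  by (cases z) (metis add.right_neutral of_nat_0 snd_conv zscan.simps)

lemma represents_act:
  assumes "represents T z" and "d \<in> {-1, 0, 1}"
  shows "represents (act T s d) (zact z s d)"
proof -
  obtain l r where z: "z = (l, r)" by (cases z)
  obtain h f where T: "T = (h, f)" by (cases T)
  have right: "f (h + int i) = nth_default 0 r i" and left: "f (h - 1 - int i) = nth_default 0 l i"
      for i
    using assms(1) by (auto simp: represents_def z T)
  have right_Suc: "f (h + 1 + int i) = nth_default 0 r (Suc i)" for i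
    using right[of "Suc i"] by (simp add: algebra_simps)
  have left_Suc: "f (h - 2 - int i) = nth_default 0 l (Suc i)" for i
    using left[of "Suc i"] by (simp add: algebra_simps)
  consider (move_right) "d = 1" | (move_left) "d = -1" | (stay) "d = 0"
    using assms(2) by auto
  then show ?thesis
  proof cases
    case move_right
    have "(f(h := s)) (h - int i) = nth_default 0 (s # l) i" for i
      using left by (cases i) (auto simp: algebra_simps)
    then show ?thesis
      using move_right right_Suc by (auto simp: represents_def z T act_def nth_default_tl)
  next
    case move_left
    have "(f(h := s)) (h - 1 + int i) = nth_default 0 (nth_default 0 l 0 # s # tl r) i" for i
      using left[of 0] right_Suc
      by (cases i; cases "i - 1") (auto simp: nth_default_tl algebra_simps)
    then show ?thesis
      using move_left left_Suc by (auto simp: represents_def z T act_def nth_default_tl)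
  next
    case stay
    have "(f(h := s)) (h + int i) = nth_default 0 (s # tl r) i" for i
      using right_Suc by (cases i) (auto simp: nth_default_tl algebra_simps)
    then show ?thesis
      using stay left by (auto simp: represents_def z T act_def)
  qed
qed

lemma act_scanned: "act T (scanned T) 0 = T"
  by (simp add: scanned_def act_def)

lemma represents_word_tape: "represents (word_tape x) ([], x)"
  by (auto simp: represents_def word_tape_def nth_default_def)

lemma tape_word_represents:
  assumes "represents T (l, y @ [0])" and "0 \<notin> set y"
  shows "tape_word T y"
proof -
  have "snd T (fst T + int i) = nth_default 0 y i" for i
    using assms(1) by (simp add: represents_def)
  moreover have "y ! j \<noteq> 0" if "j < length y" for j
    using that assms(2) by (metis nth_mem)
  ultimately show ?thesis
    by (simp add: tape_word_def nth_default_def)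
qed

section \<open>While programs and their execution by Turing machines\<close>

datatype com =
    Skip
  | Act nat "nat \<Rightarrow> nat" int
  | Seq com com  (infixr \<open>;;\<close> 60)
  | Cond nat "nat \<Rightarrow> bool" com com
  | While nat "nat \<Rightarrow> bool" com

inductive exec :: "com \<Rightarrow> zipper list \<Rightarrow> nat \<Rightarrow> zipper list \<Rightarrow> bool" where
  Skip: "exec Skip s 1 s"
| Act: "i < length s \<Longrightarrow> exec (Act i g d) s 1 (s[i := zact (s ! i) (g (zscan (s ! i))) d])"
| Seq: "exec c s t s' \<Longrightarrow> exec c' s' t' s'' \<Longrightarrow> exec (c ;; c') s (t + t') s''"
| CondT: "p (zscan (s ! i)) \<Longrightarrow> i < length s \<Longrightarrow> exec c s t s' \<Longrightarrow> exec (Cond i p c c') s (Suc t) s'"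
| CondF: "\<not> p (zscan (s ! i)) \<Longrightarrow> i < length s \<Longrightarrow> exec c' s t s' \<Longrightarrow> exec (Cond i p c c') s (Suc t) s'"
| WhileF: "\<not> p (zscan (s ! i)) \<Longrightarrow> i < length s \<Longrightarrow> exec (While i p c) s 1 s"
| WhileT: "p (zscan (s ! i)) \<Longrightarrow> i < length s \<Longrightarrow> exec c s t s' \<Longrightarrow> exec (While i p c) s' t' s''
    \<Longrightarrow> exec (While i p c) s (Suc (t + t')) s''"
| weaken: "exec c s t s' \<Longrightarrow> t \<le> t' \<Longrightarrow> exec c s t' s'"

lemma exec_length: "exec c s t s' \<Longrightarrow> length s' = length s"
  by (induction rule: exec.induct) simp_all

lemma exec_length_left:
  "exec c s t s' \<Longrightarrow> length (fst (s' ! i)) \<le> length (fst (s ! i)) + t"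
proof (induction rule: exec.induct)
  case (Act j s g d)
  then show ?case by (cases "s ! j"; cases "i = j") (auto simp: nth_list_update)
qed auto

fun num_states :: "com \<Rightarrow> nat" where
  "num_states Skip = 1"
| "num_states (Act i g d) = 1"
| "num_states (c ;; c') = num_states c + num_states c'"
| "num_states (Cond i p c c') = Suc (num_states c + num_states c')"
| "num_states (While i p c) = Suc (num_states c)"

text \<open>
  \<open>code K c q e\<close> is the transition table of \<open>c\<close> on \<open>K\<close> tapes, occupying the states
  \<open>q, \<dots>, q + num_states c - 1\<close> and leaving to the state \<open>e\<close>.
\<close>

fun code :: "nat \<Rightarrow> com \<Rightarrow> nat \<Rightarrow> nat \<Rightarrow> nat \<Rightarrow> nat list \<Rightarrow> nat \<times> nat list \<times> int list" where
  "code K Skip q e x v = (e, v, replicate K 0)"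
| "code K (Act i g d) q e x v = (e, v[i := g (v ! i)], (replicate K 0)[i := d])"
| "code K (c ;; c') q e x v =
     (if x < q + num_states c then code K c q (q + num_states c) x v
      else code K c' (q + num_states c) e x v)"
| "code K (Cond i p c c') q e x v =
     (if x = q then (if p (v ! i) then Suc q else Suc q + num_states c, v, replicate K 0)
      else if x < Suc q + num_states c then code K c (Suc q) e x v
      else code K c' (Suc q + num_states c) e x v)"
| "code K (While i p c) q e x v =
     (if x = q then (if p (v ! i) then Suc q else e, v, replicate K 0)
      else code K c (Suc q) q x v)"

fun wf_com :: "nat \<Rightarrow> nat \<Rightarrow> com \<Rightarrow> bool" where
  "wf_com K S Skip \<longleftrightarrow> True"
| "wf_com K S (Act i g d) \<longleftrightarrow> i < K \<and> (\<forall>x<S. g x < S) \<and> d \<in> {-1, 0, 1}"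
| "wf_com K S (c ;; c') \<longleftrightarrow> wf_com K S c \<and> wf_com K S c'"
| "wf_com K S (Cond i p c c') \<longleftrightarrow> i < K \<and> wf_com K S c \<and> wf_com K S c'"
| "wf_com K S (While i p c) \<longleftrightarrow> i < K \<and> wf_com K S c"

lemma wf_code:
  assumes "wf_com K S c" "length v = K" "set v \<subseteq> {..<S}"
    and "q \<le> x" "x < q + num_states c" "q + num_states c \<le> h" "e \<le> h"
  shows "case code K c q e x v of (x', w, d) \<Rightarrow> x' \<le> h \<and> length w = K \<and> set w \<subseteq> {..<S} \<and>
           length d = K \<and> set d \<subseteq> {-1, 0, 1}"
  using assms
proof (induction c arbitrary: q e)
  case Skip
  then show ?case by (auto dest!: in_set_replicate[THEN iffD1])
next
  case (Act i g d)
  have "v ! i < S" using Act by (metis lessThan_iff nth_mem subsetD wf_com.simps(2))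
  then have "set (v[i := g (v ! i)]) \<subseteq> {..<S}"
    using Act set_update_subset_insert[of v i "g (v ! i)"] by auto
  moreover have "set ((replicate K (0::int))[i := d]) \<subseteq> {-1, 0, 1}"
    using Act set_update_subset_insert[of "replicate K (0::int)" i d]
    by (auto dest!: in_set_replicate[THEN iffD1])
  ultimately show ?case using Act by simp
next
  case (Seq c1 c2)
  then show ?case
    using Seq.IH(1)[of q "q + num_states c1"] Seq.IH(2)[of "q + num_states c1" e] by simp
next
  case (Cond i p c1 c2)
  then show ?case
    using Cond.IH(1)[of "Suc q" e] Cond.IH(2)[of "Suc q + num_states c1" e]
    by (auto dest!: in_set_replicate[THEN iffD1])
next
  case (While i p c)
  then show ?case using While.IH[of "Suc q" q] by (auto dest!: in_set_replicate[THEN iffD1])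
qed

definition machine :: "nat \<Rightarrow> nat \<Rightarrow> com \<Rightarrow> tm" where
  "machine K S c = \<lparr>num_tapes = K, num_syms = S, halt_state = num_states c,
     delta = code K c 0 (num_states c)\<rparr>"

lemma wf_machine: "wf_com K S c \<Longrightarrow> K \<ge> 1 \<Longrightarrow> S \<ge> 1 \<Longrightarrow> wf_tm (machine K S c)"
  unfolding wf_tm_def machine_def using wf_code[where q = 0] by simp

definition reaches :: "tm \<Rightarrow> nat \<Rightarrow> zipper list \<Rightarrow> nat \<Rightarrow> nat \<Rightarrow> zipper list \<Rightarrow> bool" where
  "reaches M q s t q' s' \<longleftrightarrow>
     (\<forall>Ts. list_all2 represents Ts s \<longrightarrow>
        (\<exists>t' \<le> t. \<exists>Ts'. (step M ^^ t') (q, Ts) = (q', Ts') \<and> list_all2 represents Ts' s'))"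

lemma reachesE:
  assumes "reaches M q s t q' s'" "list_all2 represents Ts s"
  obtains t' Ts' where "t' \<le> t" "(step M ^^ t') (q, Ts) = (q', Ts')" "list_all2 represents Ts' s'"
  using assms unfolding reaches_def by blast

lemma reaches_mono: "reaches M q s t q' s' \<Longrightarrow> t \<le> t' \<Longrightarrow> reaches M q s t' q' s'"
  unfolding reaches_def by (meson le_trans)

lemma reaches_trans:
  assumes "reaches M q s t q' s'" "reaches M q' s' t' q'' s''"
  shows "reaches M q s (t + t') q'' s''"
  unfolding reaches_def
proof (intro allI impI)
  fix Ts assume "list_all2 represents Ts s"
  with assms(1) obtain u Ts' where first: "u \<le> t" "(step M ^^ u) (q, Ts) = (q', Ts')"
    and rep: "list_all2 represents Ts' s'"
    by (rule reachesE)
  from assms(2) rep obtain u' Ts'' where second: "u' \<le> t'" "(step M ^^ u') (q', Ts') = (q'', Ts'')"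
    and "list_all2 represents Ts'' s''"
    by (rule reachesE)
  then show "\<exists>v \<le> t + t'. \<exists>Ts''. (step M ^^ v) (q, Ts) = (q'', Ts'') \<and>
      list_all2 represents Ts'' s''"
    using first by (intro exI[of _ "u' + u"] exI[of _ Ts'']) (simp add: funpow_add)
qed

lemma reaches_SucI: "reaches M q s (Suc 0) q' s' \<Longrightarrow> reaches M q' s' t q'' s'' \<Longrightarrow>
    reaches M q s (Suc t) q'' s''"
  using reaches_trans by fastforce

lemma reaches_step:
  assumes "\<And>Ts. list_all2 represents Ts s \<Longrightarrow> \<exists>Ts'. step M (q, Ts) = (q', Ts') \<and>
      list_all2 represents Ts' s'"
  shows "reaches M q s 1 q' s'"
  unfolding reaches_def
proof (intro allI impI)
  fix Ts assume "list_all2 represents Ts s"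
  then obtain Ts' where "step M (q, Ts) = (q', Ts')" "list_all2 represents Ts' s'"
    using assms by blast
  then show "\<exists>t' \<le> 1. \<exists>Ts'. (step M ^^ t') (q, Ts) = (q', Ts') \<and> list_all2 represents Ts' s'"
    by (intro exI[of _ 1] exI[of _ Ts']) simp
qed

lemma map_scanned_represents: "list_all2 represents Ts s \<Longrightarrow> map scanned Ts = map zscan s"
  by (induction rule: list_all2_induct) (auto simp: scanned_represents)

lemma reaches_stay:
  assumes "delta M q (map zscan s) = (q', map zscan s, replicate (num_tapes M) 0)"
    and "length s = num_tapes M" "q \<noteq> halt_state M"
  shows "reaches M q s 1 q' s"
proof (rule reaches_step)
  fix Ts assume rep: "list_all2 represents Ts s"
  then have "length Ts = num_tapes M" using assms(2) by (simp add: list_all2_lengthD)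
  then have "map (\<lambda>j. act (Ts ! j) (map scanned Ts ! j) (replicate (num_tapes M) 0 ! j))
      [0..<num_tapes M] = Ts"
    by (intro nth_equalityI) (simp_all add: act_scanned)
  then have "step M (q, Ts) = (q', Ts)"
    using assms map_scanned_represents[OF rep] by (simp add: step_def)
  then show "\<exists>Ts'. step M (q, Ts) = (q', Ts') \<and> list_all2 represents Ts' s"
    using rep by blast
qed

lemma reaches_act:
  assumes "delta M q (map zscan s) =
      (q', (map zscan s)[i := a], (replicate (num_tapes M) 0)[i := d])"
    and "length s = num_tapes M" "i < length s" "q \<noteq> halt_state M" "d \<in> {-1, 0, 1}"
  shows "reaches M q s 1 q' (s[i := zact (s ! i) a d])"
proof (rule reaches_step)
  fix Ts assume rep: "list_all2 represents Ts s"
  then have scan: "map scanned Ts = map zscan s" by (rule map_scanned_represents)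
  have len: "length Ts = num_tapes M" using assms(2) rep by (simp add: list_all2_lengthD)
  define Ts' where "Ts' = map (\<lambda>j. act (Ts ! j) ((map scanned Ts)[i := a] ! j)
      ((replicate (num_tapes M) 0)[i := d] ! j)) [0..<num_tapes M]"
  have step: "step M (q, Ts) = (q', Ts')"
    using assms(1,4) by (simp add: step_def scan Ts'_def)
  have "Ts' = Ts[i := act (Ts ! i) a d]"
    using assms(2,3) unfolding Ts'_def
    by (intro nth_equalityI) (auto simp: len nth_list_update act_scanned)
  moreover have "represents (Ts ! i) (s ! i)"
    using rep assms(3) len assms(2) by (simp add: list_all2_nthD)
  ultimately have "list_all2 represents Ts' (s[i := zact (s ! i) a d])"
    using rep assms(5) by (simp add: list_all2_update_cong represents_act del: insert_iff)
  with step show "\<exists>Ts'. step M (q, Ts) = (q', Ts') \<and>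
      list_all2 represents Ts' (s[i := zact (s ! i) a d])"
    by blast
qed

definition installed :: "tm \<Rightarrow> com \<Rightarrow> nat \<Rightarrow> nat \<Rightarrow> bool" where
  "installed M c q e \<longleftrightarrow> q + num_states c \<le> halt_state M \<and>
     (\<forall>x v. q \<le> x \<and> x < q + num_states c \<longrightarrow> delta M x v = code (num_tapes M) c q e x v)"

lemma num_states_pos: "num_states c > 0"
  by (induction c) simp_all

lemma installed_entry:
  "installed M c q e \<Longrightarrow> delta M q v = code (num_tapes M) c q e q v"
  "installed M c q e \<Longrightarrow> q \<noteq> halt_state M"
  using num_states_pos[of c] by (auto simp: installed_def)

lemma installed_subprograms:
  "installed M (c ;; c') q e \<Longrightarrow> installed M c q (q + num_states c)"
  "installed M (c ;; c') q e \<Longrightarrow> installed M c' (q + num_states c) e"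
  "installed M (Cond i p c c') q e \<Longrightarrow> installed M c (Suc q) e"
  "installed M (Cond i p c c') q e \<Longrightarrow> installed M c' (Suc q + num_states c) e"
  "installed M (While i p c) q e \<Longrightarrow> installed M c (Suc q) q"
  by (auto simp: installed_def)

lemma reaches_test:
  assumes "i < length s" "length s = num_tapes M"
  shows "installed M (Cond i p c c') q e \<Longrightarrow>
      reaches M q s 1 (if p (zscan (s ! i)) then Suc q else Suc q + num_states c) s"
    and "installed M (While i p c) q e \<Longrightarrow> reaches M q s 1 (if p (zscan (s ! i)) then Suc q else e) s"
  by (rule reaches_stay; use assms in \<open>simp add: installed_entry\<close>)+

lemma reaches_exec:
  assumes "exec c s t s'" "installed M c q e" "wf_com (num_tapes M) S c" "length s = num_tapes M"
  shows "reaches M q s t e s'"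
  using assms
proof (induction arbitrary: q e rule: exec.induct)
  case (Skip s)
  then show ?case by (intro reaches_stay) (simp_all add: installed_entry)
next
  case (Act i s g d)
  then show ?case by (intro reaches_act) (auto simp: installed_entry)
next
  case (Seq c s t s' c' t' s'')
  have "reaches M q s t (q + num_states c) s'"
    using Seq by (auto intro: installed_subprograms)
  moreover have "reaches M (q + num_states c) s' t' e s''"
    using Seq exec_length[OF Seq.hyps(1)] installed_subprograms(2)[OF Seq.prems(1)] by simp
  ultimately show ?case by (rule reaches_trans)
next
  case (CondT p s i c t s' c')
  then show ?case
    using reaches_test(1)[OF CondT.hyps(2) CondT.prems(3,1)]
        installed_subprograms(3)[OF CondT.prems(1)]
    by (auto intro: reaches_SucI)
next
  case (CondF p s i c' t s' c)
  then show ?case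
    using reaches_test(1)[OF CondF.hyps(2) CondF.prems(3,1)]
        installed_subprograms(4)[OF CondF.prems(1)]
    by (auto intro: reaches_SucI)
next
  case (WhileF p s i c)
  then show ?case
    using reaches_test(2)[OF WhileF.hyps(2) WhileF.prems(3,1)] by simp
next
  case (WhileT p s i c t s' t' s'')
  have "reaches M (Suc q) s t q s'"
    using WhileT by (auto intro: installed_subprograms)
  moreover have "reaches M q s' t' e s''"
    using WhileT by (auto dest: exec_length)
  ultimately show ?case
    using reaches_test(2)[OF WhileT.hyps(2) WhileT.prems(3,1)] WhileT.hyps(1)
    by (auto intro: reaches_SucI reaches_trans)
next
  case (weaken c s t s' t')
  then show ?case by (blast intro: reaches_mono)
qed

lemma step_halted: "(step M ^^ t) (halt_state M, Ts) = (halt_state M, Ts)"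
  by (induction t) (simp_all add: step_def)

lemma list_all2_replicate: "P x y \<Longrightarrow> list_all2 P (replicate n x) (replicate n y)"
  by (induction n) simp_all

lemma machine_computes:
  assumes exec: "exec c (([], x) # replicate (K - 1) ([], [])) t s'" and "wf_com K S c" "K \<ge> 1"
    and out: "last s' = (l, y @ [0])" "0 \<notin> set y" and "set x \<subseteq> {1..<S}"
  shows "computes_within (machine K S c) x y t"
proof -
  let ?M = "machine K S c"
  define Ts where "Ts = snd (init ?M x)"
  have "list_all2 represents Ts (([], x) # replicate (K - 1) ([], []))"
    by (simp add: Ts_def init_def machine_def represents_word_tape list_all2_replicate)
  moreover have "reaches ?M 0 (([], x) # replicate (K - 1) ([], [])) t (num_states c) s'"
    by (rule reaches_exec[OF exec, where S = S])
       (use assms(2,3) in \<open>simp_all add: installed_def machine_def\<close>)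
  ultimately obtain t' Ts' where t': "t' \<le> t" "(step ?M ^^ t') (0, Ts) = (num_states c, Ts')"
    and rep: "list_all2 represents Ts' s'"
    by (blast elim: reachesE)
  have "(step ?M ^^ t) (0, Ts) = (step ?M ^^ (t - t')) ((step ?M ^^ t') (0, Ts))"
    using t'(1) by (metis comp_apply funpow_add le_add_diff_inverse2)
  also have "\<dots> = (num_states c, Ts')"
    unfolding t'(2) using step_halted[of "t - t'" ?M Ts'] by (simp add: machine_def)
  finally have halted: "(step ?M ^^ t) (init ?M x) = (num_states c, Ts')"
    by (simp add: Ts_def init_def)
  have "s' \<noteq> []"
    using exec_length[OF exec] by auto
  then have "represents (last Ts') (last s')"
    using rep by (metis last_conv_nth list_all2_lengthD list_all2_nthD length_greater_0_conv
        diff_less zero_less_one)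
  then have "tape_word (last Ts') y"
    using out tape_word_represents by simp
  then show ?thesis
    using halted assms(6) by (simp add: computes_within_def machine_def)
qed

section \<open>Loops and moves\<close>

lemma exec_ActI:
  "i < length s \<Longrightarrow> s' = s[i := zact (s ! i) (g (zscan (s ! i))) d] \<Longrightarrow> exec (Act i g d) s 1 s'"
  using exec.Act by blast

lemma exec_eqI: "exec c s t s1 \<Longrightarrow> t \<le> t' \<Longrightarrow> s1 = s2 \<Longrightarrow> exec c s t' s2"
  by (simp add: exec.weaken)

text \<open>\<open>\<sigma> xs ys\<close> is the state in which the items \<open>xs\<close> have been processed and the items \<open>ys\<close> remain.\<close>

lemma exec_While_list:
  assumes body: "\<And>xs x ys. zs = xs @ x # ys \<Longrightarrow> exec c (\<sigma> xs (x # ys)) (\<tau> x) (\<sigma> (xs @ [x]) ys)"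
    and continue: "\<And>xs x ys. zs = xs @ x # ys \<Longrightarrow> p (zscan (\<sigma> xs (x # ys) ! i))"
    and stop: "\<not> p (zscan (\<sigma> zs [] ! i))"
    and tape: "\<And>xs ys. i < length (\<sigma> xs ys)"
  shows "exec (While i p c) (\<sigma> [] zs) (Suc (\<Sum>x\<leftarrow>zs. Suc (\<tau> x))) (\<sigma> zs [])"
proof -
  have "exec (While i p c) (\<sigma> xs ys) (Suc (\<Sum>x\<leftarrow>ys. Suc (\<tau> x))) (\<sigma> zs [])" if "zs = xs @ ys" for xs ys
    using that
  proof (induction ys arbitrary: xs)
    case Nil
    then show ?case using exec.WhileF[of p "\<sigma> zs []" i c] stop tape by simp
  next
    case (Cons y ys)
    have "exec (While i p c) (\<sigma> xs (y # ys)) (Suc (\<tau> y + Suc (\<Sum>x\<leftarrow>ys. Suc (\<tau> x)))) (\<sigma> zs [])"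
      by (rule exec.WhileT[OF continue tape body Cons.IH]) (use Cons.prems in auto)
    then show ?case by simp
  qed
  from this[of "[]" zs] show ?thesis by simp
qed

abbreviation move :: "nat \<Rightarrow> int \<Rightarrow> com" where
  "move i d \<equiv> Act i (\<lambda>a. a) d"

fun step_left :: "zipper \<Rightarrow> zipper" where
  "step_left (l, r) = (tl l, nth_default 0 l 0 # r)"

lemma exec_move_left:
  "i < length s \<Longrightarrow> s ! i = (l, r) \<Longrightarrow>
      exec (move i (-1)) s 1 (s[i := step_left (l, nth_default 0 r 0 # tl r)])"
  by (rule exec_ActI) simp_all

lemma exec_While_move_right:
  assumes "i < length s" "s ! i = (l, x @ r)" "\<forall>a\<in>set x. p a" "\<not> p (nth_default 0 r 0)"
  shows "exec (While i p (move i 1)) s (2 * length x + 1) (s[i := (rev x @ l, r)])"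
proof -
  define \<sigma> where "\<sigma> xs ys = s[i := (rev xs @ l, ys @ r)]" for xs ys
  have loop: "exec (While i p (move i 1)) (\<sigma> [] x) (Suc (\<Sum>a\<leftarrow>x. Suc 1)) (\<sigma> x [])"
  proof (rule exec_While_list)
    fix xs a ys
    show "exec (move i 1) (\<sigma> xs (a # ys)) 1 (\<sigma> (xs @ [a]) ys)"
      by (rule exec_ActI) (use assms(1) in \<open>simp_all add: \<sigma>_def\<close>)
  qed (use assms in \<open>auto simp: \<sigma>_def\<close>)
  have start: "\<sigma> [] x = s"
    using list_update_id[of s i] assms(2) by (simp add: \<sigma>_def)
  show ?thesis
    by (rule exec_eqI[OF loop[unfolded start]]) (simp_all add: \<sigma>_def sum_list_triv)
qed

definition rewind :: "nat \<Rightarrow> com" where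
  "rewind i = move i (-1) ;; While i (\<lambda>a. a \<noteq> 0) (move i (-1)) ;; move i 1"

lemma exec_rewind:
  assumes i: "i < length s" and s: "s ! i = (rev x @ l, r)" and x: "0 \<notin> set x"
    and l: "nth_default 0 l 0 = 0"
  shows "exec (rewind i) s (2 * length x + 3) (s[i := (0 # tl l, x @ nth_default 0 r 0 # tl r)])"
proof -
  let ?r = "nth_default 0 r 0 # tl r"
  define \<sigma> where "\<sigma> xs ys = s[i := step_left (ys @ l, rev xs @ ?r)]" for xs ys
  have enter: "exec (move i (-1)) s 1 (\<sigma> [] (rev x))"
    using exec_move_left[OF i s] by (simp add: \<sigma>_def)
  have loop: "exec (While i (\<lambda>a. a \<noteq> 0) (move i (-1))) (\<sigma> [] (rev x)) (Suc (\<Sum>a\<leftarrow>rev x. Suc 1))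
      (\<sigma> (rev x) [])"
  proof (rule exec_While_list)
    fix xs a ys
    show "exec (move i (-1)) (\<sigma> xs (a # ys)) 1 (\<sigma> (xs @ [a]) ys)"
      by (rule exec_ActI) (use i in \<open>simp_all add: \<sigma>_def\<close>)
    assume "rev x = xs @ a # ys"
    then have "a \<in> set x" by (metis in_set_conv_decomp set_rev)
    then have "a \<noteq> 0" using x by metis
    then show "zscan (\<sigma> xs (a # ys) ! i) \<noteq> 0"
      using i by (simp add: \<sigma>_def)
  qed (use i l in \<open>auto simp: \<sigma>_def\<close>)
  have return: "exec (move i 1) (\<sigma> (rev x) []) 1 (s[i := (0 # tl l, x @ ?r)])"
    by (rule exec_ActI) (use i l in \<open>simp_all add: \<sigma>_def\<close>)
  show ?thesis
    unfolding rewind_def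
    by (rule exec_eqI[OF exec.Seq[OF enter exec.Seq[OF loop return]]]) (simp_all add: sum_list_triv)
qed

section \<open>Transducers\<close>

text \<open>
  The words \<open>w\<close> and \<open>v\<close> are read from the first tape and written to the last one; they
  are reversed when they have been passed, as zippers list the cells to the left nearest first.
\<close>

definition transduces ::
  "com \<Rightarrow> zipper list \<Rightarrow> nat list \<Rightarrow> nat \<Rightarrow> zipper list \<Rightarrow> nat list \<Rightarrow> bool" where
  "transduces c us w t us' v \<longleftrightarrow>
     (\<forall>l x b. exec c ((l, w @ x) # us @ [(b, [])]) t ((rev w @ l, x) # us' @ [(rev v @ b, [])]))"

lemma transduces_exec:
  "transduces c us w t us' v \<Longrightarrow>
     exec c ((l, w @ x) # us @ [(b, [])]) t ((rev w @ l, x) # us' @ [(rev v @ b, [])])"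
  by (simp add: transduces_def)

lemma transduces_eqI:
  assumes "transduces c us w t us' v" "w = w1" "t \<le> t1" "us' = us1" "v = v1"
  shows "transduces c us w1 t1 us1 v1"
  unfolding transduces_def
  using exec.weaken[OF transduces_exec[OF assms(1)] assms(3)] unfolding assms(2,4,5) by blast

lemma transduces_Skip: "transduces Skip us [] 1 us []"
  unfolding transduces_def using exec.Skip by simp

lemma transduces_Seq:
  assumes "transduces c us w t us' v" "transduces c' us' w' t' us'' v'"
  shows "transduces (c ;; c') us (w @ w') (t + t') us'' (v @ v')"
  unfolding transduces_def
proof (intro allI)
  fix l x b
  show "exec (c ;; c') ((l, (w @ w') @ x) # us @ [(b, [])]) (t + t')
      ((rev (w @ w') @ l, x) # us'' @ [(rev (v @ v') @ b, [])])"
    using exec.Seq[OF transduces_exec[OF assms(1)] transduces_exec[OF assms(2)]] by simp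
qed

lemma transduces_Act:
  assumes "i < length us" "us' = us[i := zact (us ! i) (g (zscan (us ! i))) d]"
  shows "transduces (Act (Suc i) g d) us [] 1 us' []"
  unfolding transduces_def
  by (intro allI exec_ActI) (use assms in \<open>simp_all add: nth_append list_update_append\<close>)

lemma transduces_read: "transduces (move 0 1) us [a] 1 us []"
  unfolding transduces_def by (intro allI exec_ActI) simp_all

lemma transduces_write: "transduces (Act (Suc (length us)) (\<lambda>_. a) 1) us [] 1 us [a]"
  unfolding transduces_def by (intro allI exec_ActI) (simp_all add: nth_append list_update_append)

lemma transduces_Cond:
  assumes "i < length us"
    and "p (zscan (us ! i)) \<Longrightarrow> transduces c us w t us' v"
    and "\<not> p (zscan (us ! i)) \<Longrightarrow> transduces c' us w t us' v"
  shows "transduces (Cond (Suc i) p c c') us w (Suc t) us' v"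
  unfolding transduces_def
  by (cases "p (zscan (us ! i))")
     (use assms in \<open>simp_all add: exec.CondT exec.CondF transduces_exec nth_append\<close>)

lemma transduces_lookahead:
  assumes "w \<noteq> []"
    and "p (hd w) \<Longrightarrow> transduces c us [] t us' v"
    and "\<not> p (hd w) \<Longrightarrow> transduces c' us [] t us' v"
    and "transduces d us' w t' us'' v'"
  shows "transduces (Cond 0 p c c' ;; d) us w (Suc t + t') us'' (v @ v')"
proof -
  have "exec (Cond 0 p c c') ((l, w @ x) # us @ [(b, [])]) (Suc t)
      ((l, w @ x) # us' @ [(rev v @ b, [])])" for l x b
  proof (cases "p (hd w)")
    case True
    show ?thesis
      by (rule exec.CondT)
         (use True assms(1) transduces_exec[OF assms(2), OF True, of l "w @ x"] in \<open>cases w; simp\<close>)+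
  next
    case False
    show ?thesis
      by (rule exec.CondF)
         (use False assms(1) transduces_exec[OF assms(3), OF False, of l "w @ x"]
          in \<open>cases w; simp\<close>)+
  qed
  then show ?thesis
    unfolding transduces_def
    using exec.Seq[OF _ transduces_exec[OF assms(4)]] by (metis append_assoc rev_append)
qed

lemma transduces_While:
  assumes body: "\<And>xs x ys. zs = xs @ x # ys \<Longrightarrow> transduces c (\<sigma> xs (x # ys)) [] t (\<sigma> (xs @ [x]) ys) v"
    and continue: "\<And>xs x ys. zs = xs @ x # ys \<Longrightarrow> p (zscan (\<sigma> xs (x # ys) ! i))"
    and stop: "\<not> p (zscan (\<sigma> zs [] ! i))"
    and tape: "\<And>xs ys. i < length (\<sigma> xs ys)"
  shows "transduces (While (Suc i) p c) (\<sigma> [] zs) [] (Suc (length zs * Suc t)) (\<sigma> zs [])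
           (concat (replicate (length zs) v))"
  unfolding transduces_def
proof (intro allI)
  fix l x b
  define \<rho> where "\<rho> xs ys = (l, x) # \<sigma> xs ys @ [(rev (concat (replicate (length xs) v)) @ b, [])]"
      for xs ys
  have "exec (While (Suc i) p c) (\<rho> [] zs) (Suc (\<Sum>z\<leftarrow>zs. Suc t)) (\<rho> zs [])"
  proof (rule exec_While_list)
    have "concat (replicate (Suc n) v) = concat (replicate n v) @ v" for n
      by (simp flip: replicate_append_same)
    moreover fix xs y ys assume "zs = xs @ y # ys"
    ultimately show "exec c (\<rho> xs (y # ys)) t (\<rho> (xs @ [y]) ys)"
      using transduces_exec[OF body, of xs y ys l x "rev (concat (replicate (length xs) v)) @ b"]
      by (simp add: \<rho>_def del: replicate_Suc)
  qed (use continue stop tape in \<open>simp_all add: \<rho>_def nth_append less_SucI\<close>)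
  then show "exec (While (Suc i) p c) ((l, [] @ x) # \<sigma> [] zs @ [(b, [])]) (Suc (length zs * Suc t))
      ((rev [] @ l, x) # \<sigma> zs [] @ [(rev (concat (replicate (length zs) v)) @ b, [])])"
    by (simp add: \<rho>_def sum_list_triv)
qed

definition read_until :: "nat \<Rightarrow> com \<Rightarrow> com" where
  "read_until z c = While 0 (\<lambda>a. a \<noteq> z) c ;; move 0 1"

definition foreach :: "com \<Rightarrow> com" where
  "foreach c = move 0 1 ;; read_until 5 c"

lemma sum_list_Suc_le_length_concat:
  assumes "\<And>x. x \<in> set xs \<Longrightarrow> enc x \<noteq> []"
  shows "(\<Sum>x\<leftarrow>xs. Suc (C * length (enc x))) \<le> Suc C * length (concat (map enc xs))"
  using assms
proof (induction xs)
  case (Cons x xs)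
  have "Suc (C * length (enc x)) \<le> Suc C * length (enc x)"
    using Cons.prems by (simp add: Suc_le_eq)
  then show ?case
    using Cons by (simp add: algebra_simps)
qed simp

lemma transduces_read_until:
  assumes out: "V [] = []" "\<And>ys y. V (ys @ [y]) = V ys @ v ys y"
    and body: "\<And>ys y zs. xs = ys @ y # zs \<Longrightarrow>
      transduces c (\<sigma> ys) (enc y) (C * length (enc y)) (\<sigma> (ys @ [y])) (v ys y)"
    and enc: "\<And>y. y \<in> set xs \<Longrightarrow> enc y \<noteq> [] \<and> hd (enc y) \<noteq> z"
  shows "transduces (read_until z c) (\<sigma> []) (concat (map enc xs) @ [z])
           (Suc C * length (concat (map enc xs)) + 2) (\<sigma> xs) (V xs)"
  unfolding transduces_def
proof (intro allI)
  fix l x b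
  define \<rho> where
    "\<rho> ys zs = (rev (concat (map enc ys)) @ l, concat (map enc zs) @ z # x) #
        \<sigma> ys @ [(rev (V ys) @ b, [])]" for ys zs
  have "exec (While 0 (\<lambda>a. a \<noteq> z) c) (\<rho> [] xs) (Suc (\<Sum>y\<leftarrow>xs. Suc (C * length (enc y)))) (\<rho> xs [])"
  proof (rule exec_While_list)
    fix ys y zs assume xs: "xs = ys @ y # zs"
    show "exec c (\<rho> ys (y # zs)) (C * length (enc y)) (\<rho> (ys @ [y]) zs)"
      using transduces_exec[OF body[OF xs]] by (simp add: \<rho>_def out)
    show "zscan (\<rho> ys (y # zs) ! 0) \<noteq> z"
      using enc[of y] xs by (cases "enc y") (simp_all add: \<rho>_def)
  qed (simp_all add: \<rho>_def)
  moreover have "exec (move 0 1) (\<rho> xs []) 1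
      ((z # rev (concat (map enc xs)) @ l, x) # \<sigma> xs @ [(rev (V xs) @ b, [])])"
    by (rule exec_ActI) (simp_all add: \<rho>_def)
  ultimately have run: "exec (read_until z c) (\<rho> [] xs) (Suc (\<Sum>y\<leftarrow>xs. Suc (C * length (enc y))) + 1)
      ((z # rev (concat (map enc xs)) @ l, x) # \<sigma> xs @ [(rev (V xs) @ b, [])])"
    unfolding read_until_def by (rule exec.Seq)
  have start: "\<rho> [] xs = (l, (concat (map enc xs) @ [z]) @ x) # \<sigma> [] @ [(b, [])]"
    by (simp add: \<rho>_def out(1))
  show "exec (read_until z c) ((l, (concat (map enc xs) @ [z]) @ x) # \<sigma> [] @ [(b, [])])
      (Suc C * length (concat (map enc xs)) + 2)
      ((rev (concat (map enc xs) @ [z]) @ l, x) # \<sigma> xs @ [(rev (V xs) @ b, [])])"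
    by (rule exec_eqI[OF run[unfolded start]])
       (use enc sum_list_Suc_le_length_concat[of xs enc C] in simp_all)
qed

lemma transduces_foreach:
  assumes "V [] = []" "\<And>ys y. V (ys @ [y]) = V ys @ v ys y"
    and "\<And>ys y zs. xs = ys @ y # zs \<Longrightarrow>
      transduces c (\<sigma> ys) (enc y) (C * length (enc y)) (\<sigma> (ys @ [y])) (v ys y)"
    and "\<And>y. y \<in> set xs \<Longrightarrow> enc y \<noteq> [] \<and> hd (enc y) \<noteq> 5"
  shows "transduces (foreach c) (\<sigma> []) (enc_list enc xs) ((C + 2) * length (enc_list enc xs)) (\<sigma> xs)
      (V xs)"
proof -
  have "transduces (foreach c) (\<sigma> []) ([4] @ concat (map enc xs) @ [5])
      (1 + (Suc C * length (concat (map enc xs)) + 2)) (\<sigma> xs) ([] @ V xs)"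
    unfolding foreach_def
    by (rule transduces_Seq[OF transduces_read transduces_read_until[OF assms]])
  then show ?thesis
    unfolding enc_list_def by (rule transduces_eqI) (simp_all add: algebra_simps)
qed

section \<open>Four tapes\<close>

text \<open>
  Tape 0 holds the input, tape 1 a unary counter, tape 2 a register for the current coefficient
  in a single cell, and tape 3 the output.
\<close>

fun emit :: "nat list \<Rightarrow> com" where
  "emit [] = Skip"
| "emit (a # w) = Act 3 (\<lambda>_. a) 1 ;; emit w"

abbreviation set_reg :: "nat \<Rightarrow> com" where "set_reg a \<equiv> Act 2 (\<lambda>_. a) 0"
abbreviation negate_reg :: com where "negate_reg \<equiv> Act 2 (\<lambda>a. 3 - a) 0"

lemma transduces_emit: "transduces (emit w) [u, f] [] (Suc (length w)) [u, f] w"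
proof (induction w)
  case Nil
  then show ?case using transduces_Skip by simp
next
  case (Cons a w)
  have "transduces (Act 3 (\<lambda>_. a) 1) [u, f] [] 1 [u, f] [a]"
    using transduces_write[of "[u, f]" a] by (simp add: numeral_3_eq_3)
  from transduces_Seq[OF this Cons.IH] show ?case by simp
qed

lemma transduces_counter:
  "zact u (g (zscan u)) d = u' \<Longrightarrow> transduces (Act 1 g d) [u, f] [] 1 [u', f] []"
  using transduces_Act[of 0 "[u, f]" "[u', f]" g d] by simp

lemma transduces_reg: "transduces (Act 2 g 0) [u, ([], [a])] [] 1 [u, ([], [g a])] []"
  using transduces_Act[of 1 "[u, ([], [a])]" "[u, ([], [g a])]" g 0] by (simp add: numeral_2_eq_2)

definition sweep :: "(nat \<Rightarrow> bool) \<Rightarrow> nat list \<Rightarrow> int \<Rightarrow> com" where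
  "sweep p w d = While 1 p (emit w ;; move 1 d)"

lemma transduces_emit_move:
  "zact u (zscan u) d = u' \<Longrightarrow> transduces (emit w ;; move 1 d) [u, f] [] (length w + 2) [u', f] w"
  using transduces_Seq[OF transduces_emit transduces_counter] by fastforce

lemma transduces_sweep_right:
  assumes "\<forall>a\<in>set x. p a" "\<not> p (nth_default 0 r 0)"
  shows "transduces (sweep p w 1) [(l, x @ r), f] [] (Suc (length x * (length w + 3)))
      [(rev x @ l, r), f] (concat (replicate (length x) w))"
proof -
  define \<sigma> where "\<sigma> xs ys = [(rev xs @ l, ys @ r), f]" for xs ys
  have "transduces (While (Suc 0) p (emit w ;; move 1 1)) (\<sigma> [] x) []
      (Suc (length x * Suc (length w + 2))) (\<sigma> x []) (concat (replicate (length x) w))"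
  proof (rule transduces_While)
    fix xs a ys
    show "transduces (emit w ;; move 1 1) (\<sigma> xs (a # ys)) [] (length w + 2) (\<sigma> (xs @ [a]) ys) w"
      unfolding \<sigma>_def by (rule transduces_emit_move) simp
  qed (use assms in \<open>auto simp: \<sigma>_def\<close>)
  then show ?thesis
    by (simp add: sweep_def \<sigma>_def numeral_3_eq_3)
qed

lemma transduces_sweep_left:
  assumes "\<forall>a\<in>set x. p a" "\<not> p y"
  shows "transduces (sweep p w (-1)) [step_left (rev x @ y # l, r), f] []
      (Suc (length x * (length w + 3))) [(l, y # x @ r), f] (concat (replicate (length x) w))"
proof -
  define \<sigma> where "\<sigma> xs ys = [step_left (ys @ y # l, rev xs @ r), f]" for xs ys
  have "transduces (While (Suc 0) p (emit w ;; move 1 (-1))) (\<sigma> [] (rev x)) []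
      (Suc (length (rev x) * Suc (length w + 2))) (\<sigma> (rev x) [])
      (concat (replicate (length (rev x)) w))"
  proof (rule transduces_While)
    fix xs a ys
    show "transduces (emit w ;; move 1 (-1)) (\<sigma> xs (a # ys)) [] (length w + 2) (\<sigma> (xs @ [a]) ys) w"
      unfolding \<sigma>_def by (rule transduces_emit_move) simp
    assume "rev x = xs @ a # ys"
    then have "a \<in> set x" by (metis in_set_conv_decomp set_rev)
    then show "p (zscan (\<sigma> xs (a # ys) ! 0))"
      using assms(1) by (simp add: \<sigma>_def)
  qed (use assms(2) in \<open>simp_all add: \<sigma>_def\<close>)
  then show ?thesis
    by (simp add: sweep_def \<sigma>_def numeral_3_eq_3)
qed

section \<open>Binary numbers\<close>

lemma bits_0 [simp]: "bits 0 = []"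
  by (simp add: bits.simps)

lemma bits_double: "n > 0 \<Longrightarrow> bits (2 * n) = 1 # bits n"
  by (subst bits.simps) simp

lemma bits_double_Suc: "bits (Suc (2 * n)) = 2 # bits n"
  by (subst bits.simps) simp

lemma set_bits: "set (bits n) \<subseteq> {1, 2}"
  by (induction n rule: nat_bit_induct) (simp_all add: bits_double bits_double_Suc)

lemma length_bits_le: "length (bits n) \<le> n"
  by (induction n rule: nat_bit_induct) (simp_all add: bits_double bits_double_Suc)

lemma enc_nat_small: "enc_nat 0 = [3]" "enc_nat (Suc 0) = [2, 3]" "enc_nat 2 = [1, 2, 3]"
  using bits_double[of 1] bits_double_Suc[of 0] by (simp_all add: enc_nat_def)

lemma enc_nat_not_Nil: "enc_nat n \<noteq> []"
  by (simp add: enc_nat_def)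

lemma hd_enc_nat: "hd (enc_nat n) = (if n = 0 then 3 else 1 + n mod 2)"
  unfolding enc_nat_def by (subst bits.simps) simp

lemma hd_enc_nat_eq_2_iff: "hd (enc_nat n) = 2 \<longleftrightarrow> odd n"
  by (auto simp: hd_enc_nat odd_iff_mod_2_eq_one)

lemma hd_enc_nat_neq_5: "hd (enc_nat n) \<noteq> 5"
  using mod_less_divisor[of 2 n] by (auto simp: hd_enc_nat)

section \<open>Numbering monomials\<close>

type_synonym terms = "(nat \<times> nat list) list"

text \<open>
  A term is a coefficient with the exponents of the leading variables. As the exponents
  0 and 2 are interchangeable at \<open>\<plusminus>1\<close>, the last \<open>L\<close> exponents can hold a serial number that makes
  all monomials distinct.
\<close>

definition numbered_monomial :: "nat \<Rightarrow> nat \<Rightarrow> nat \<times> nat list \<Rightarrow> nat \<times> nat list" where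
  "numbered_monomial L k m =
     (fst m, snd m @ replicate (L - length (snd m)) 0 @ replicate k 2 @ replicate (L - k) 0)"

fun numbered_poly :: "nat \<Rightarrow> nat \<Rightarrow> terms \<Rightarrow> expanded_poly" where
  "numbered_poly L k [] = []"
| "numbered_poly L k (m # ms) = numbered_monomial L k m # numbered_poly L (Suc k) ms"

fun numbered_system :: "nat \<Rightarrow> nat \<Rightarrow> terms list \<Rightarrow> expanded_poly list" where
  "numbered_system L k [] = []"
| "numbered_system L k (ms # mss) = numbered_poly L k ms # numbered_system L (k + length ms) mss"

abbreviation enc_nats :: "nat list \<Rightarrow> nat list" where
  "enc_nats v \<equiv> concat (map enc_nat v)"

abbreviation enc_terms :: "nat \<Rightarrow> nat \<Rightarrow> terms \<Rightarrow> nat list" where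
  "enc_terms L k ms \<equiv> concat (map enc_monomial (numbered_poly L k ms))"

abbreviation enc_system :: "nat \<Rightarrow> nat \<Rightarrow> terms list \<Rightarrow> nat list" where
  "enc_system L k mss \<equiv> concat (map (enc_list enc_monomial) (numbered_system L k mss))"

lemma numbered_poly_append:
  "numbered_poly L k (ms @ ms') = numbered_poly L k ms @ numbered_poly L (k + length ms) ms'"
  by (induction ms arbitrary: k) simp_all

lemma numbered_system_append:
  "numbered_system L k (mss @ mss') =
      numbered_system L k mss @ numbered_system L (k + length (concat mss)) mss'"
  by (induction mss arbitrary: k) (simp_all add: add_ac)

text \<open>
  The counter after \<open>k\<close> monomials have been written. Sweeping over it to the right pads the
  exponents of the variables, sweeping back writes and advances the serial number.
\<close>

definition serial_tape :: "nat \<Rightarrow> nat \<Rightarrow> nat list" where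
  "serial_tape L k = replicate (L - k) 1 @ replicate k 2"

abbreviation work_tapes :: "nat \<Rightarrow> nat \<Rightarrow> nat \<Rightarrow> zipper list" where
  "work_tapes L k f \<equiv> [([0], serial_tape L k @ [0]), ([], [f])]"

definition pad_exponents :: com where
  "pad_exponents = sweep (\<lambda>a. a \<noteq> 0) (enc_nat 0) 1 ;; move 1 (-1)"

definition write_serial :: com where
  "write_serial = sweep (\<lambda>a. a = 2) (enc_nat 2) (-1) ;; Act 1 (\<lambda>_. 2) 0 ;;
     sweep (\<lambda>a. a \<noteq> 0) (enc_nat 0) (-1) ;; move 1 1"

definition finish_monomial :: com where
  "finish_monomial = pad_exponents ;; write_serial ;; emit [5]"

lemma transduces_pad_exponents:
  assumes "\<forall>a\<in>set ys. a \<noteq> 0"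
  shows "transduces pad_exponents [(rev xs @ [0], ys @ [0]), f] [] (4 * length ys + 2)
           [step_left (rev (xs @ ys) @ [0], [0]), f] (enc_nats (replicate (length ys) 0))"
proof -
  have pad: "transduces (sweep (\<lambda>a. a \<noteq> 0) (enc_nat 0) 1) [(rev xs @ [0], ys @ [0]), f] []
      (Suc (length ys * (length (enc_nat 0) + 3))) [(rev ys @ rev xs @ [0], [0]), f]
      (concat (replicate (length ys) (enc_nat 0)))"
    by (rule transduces_sweep_right) (use assms in simp_all)
  have turn: "transduces (move 1 (-1)) [(rev ys @ rev xs @ [0], [0]), f] [] 1
      [step_left (rev ys @ rev xs @ [0], [0]), f] []"
    by (rule transduces_counter) simp
  show ?thesis
    unfolding pad_exponents_def
    by (rule transduces_eqI[OF transduces_Seq[OF pad turn]]) (simp_all add: enc_nat_small)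
qed

lemma transduces_write_serial:
  assumes "k < L"
  shows "transduces write_serial [step_left (rev (serial_tape L k) @ [0], [0]), f] [] (6 * L + 4)
           [([0], serial_tape L (Suc k) @ [0]), f] (enc_nats (replicate k 2 @ replicate (L - k) 0))"
proof -
  obtain m where m: "L = Suc (k + m)" using assms less_iff_Suc_add by auto
  have count: "transduces (sweep (\<lambda>a. a = 2) (enc_nat 2) (-1))
      [step_left (rev (serial_tape L k) @ [0], [0]), f] [] (Suc (k * (length (enc_nat 2) + 3)))
      [(replicate m 1 @ [0], 1 # replicate k 2 @ [0]), f] (concat (replicate k (enc_nat 2)))"
    using transduces_sweep_left[of "replicate k 2" "\<lambda>a. a = 2" 1 "enc_nat 2" "replicate m 1 @ [0]"]
    by (simp add: serial_tape_def m replicate_app_Cons_same)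
  have mark: "transduces (Act 1 (\<lambda>_. 2) 0) [(replicate m 1 @ [0], 1 # replicate k 2 @ [0]), f] [] 1
      [step_left (rev (replicate m 1 @ [2]) @ 0 # [], replicate k 2 @ [0]), f] []"
    by (rule transduces_counter) simp
  have fill: "transduces (sweep (\<lambda>a. a \<noteq> 0) (enc_nat 0) (-1))
      [step_left (rev (replicate m 1 @ [2]) @ 0 # [], replicate k 2 @ [0]), f] []
      (Suc (length (replicate m 1 @ [2::nat]) * (length (enc_nat 0) + 3)))
      [([], 0 # (replicate m 1 @ [2]) @ replicate k 2 @ [0]), f]
      (concat (replicate (length (replicate m 1 @ [2::nat])) (enc_nat 0)))"
    by (rule transduces_sweep_left) auto
  have return: "transduces (move 1 1) [([], 0 # (replicate m 1 @ [2]) @ replicate k 2 @ [0]), f]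
      [] 1 [([0], serial_tape L (Suc k) @ [0]), f] []"
    by (rule transduces_counter) (simp add: serial_tape_def m replicate_app_Cons_same)
  show ?thesis
    unfolding write_serial_def
    by (rule transduces_eqI, (rule transduces_Seq count mark fill return)+)
       (auto simp: m enc_nat_small)
qed

lemma transduces_finish_monomial:
  assumes tape: "xs @ ys = serial_tape L k" and k: "k < L"
  shows "transduces finish_monomial [(rev xs @ [0], ys @ [0]), f] [] (10 * L + 8)
     [([0], serial_tape L (Suc k) @ [0]), f]
     (enc_nats (replicate (length ys) 0 @ replicate k 2 @ replicate (L - k) 0) @ [5])"
proof -
  have "length (xs @ ys) = L"
    unfolding tape using k by (simp add: serial_tape_def)
  then have len: "length ys \<le> L" by simp
  have "\<forall>a\<in>set (xs @ ys). a \<noteq> 0"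
    unfolding tape by (auto simp: serial_tape_def)
  then have pad: "transduces pad_exponents [(rev xs @ [0], ys @ [0]), f] [] (4 * length ys + 2)
      [step_left (rev (serial_tape L k) @ [0], [0]), f] (enc_nats (replicate (length ys) 0))"
    unfolding tape[symmetric] by (intro transduces_pad_exponents) simp
  show ?thesis
    unfolding finish_monomial_def
    by (rule transduces_eqI, (rule transduces_Seq pad transduces_write_serial k transduces_emit)+)
       (use len in simp_all)
qed

section \<open>Writing the polynomials of the gates\<close>

lemma enc_numbered_monomial:
  "enc_monomial (numbered_monomial L k (a, v)) = enc_nat a @ [4] @ enc_nats v @
     enc_nats (replicate (L - length v) 0 @ replicate k 2 @ replicate (L - k) 0) @ [5]"
  by (simp add: enc_monomial_def numbered_monomial_def enc_list_def)

definition write_coeff :: com where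
  "write_coeff = Cond 2 (\<lambda>a. a = 1) (emit (enc_nat 1)) (emit (enc_nat 2))"

lemma transduces_write_coeff:
  assumes "a \<in> {1, 2}"
  shows "transduces write_coeff [u, ([], [a])] [] 5 [u, ([], [a])] (enc_nat a)"
proof -
  have "transduces (emit (enc_nat b)) [u, ([], [a])] [] 4 [u, ([], [a])] (enc_nat b)"
      if "b \<in> {1, 2}" for b
    by (rule transduces_eqI[OF transduces_emit]) (use that in \<open>auto simp: enc_nat_small\<close>)
  then show ?thesis
    using transduces_Cond[of 1 "[u, ([], [a])]" "\<lambda>a. a = 1" _ "[]" 4] assms
    by (auto simp: write_coeff_def numeral_2_eq_2)
qed

definition write_constant :: com where
  "write_constant = write_coeff ;; emit [4] ;; finish_monomial"

lemma transduces_write_constant: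
  assumes "a \<in> {1, 2}" "k < L"
  shows "transduces write_constant (work_tapes L k a) [] (10 * L + 15) (work_tapes L (Suc k) a)
      (enc_terms L k [(a, [])])"
proof -
  have finish: "transduces finish_monomial (work_tapes L k a) [] (10 * L + 8)
      (work_tapes L (Suc k) a)
      (enc_nats (replicate L 0 @ replicate k 2 @ replicate (L - k) 0) @ [5])"
    using transduces_finish_monomial[of "[]" "serial_tape L k" L k] assms(2)
    by (simp add: serial_tape_def)
  show ?thesis
    unfolding write_constant_def
    by (rule transduces_eqI, (rule transduces_Seq transduces_write_coeff assms(1) transduces_emit
        finish)+)
       (simp_all add: enc_numbered_monomial)
qed

definition skip_nat :: com where
  "skip_nat = read_until 3 (move 0 1)"

lemma transduces_skip_nat: "transduces skip_nat us (enc_nat n) (2 * length (enc_nat n)) us []"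
proof -
  have "transduces skip_nat us (concat (map (\<lambda>d. [d]) (bits n)) @ [3])
      (Suc 1 * length (concat (map (\<lambda>d. [d]) (bits n))) + 2) us []"
    unfolding skip_nat_def
    by (rule transduces_read_until[where V = "\<lambda>_. []" and v = "\<lambda>_ _. []"])
       (use set_bits[of n] transduces_read in auto)
  then show ?thesis by (rule transduces_eqI) (simp_all add: enc_nat_def)
qed

definition on_parity :: "com \<Rightarrow> com \<Rightarrow> com" where
  "on_parity c c' = Cond 0 (\<lambda>a. a = 2) c c' ;; skip_nat"

lemma transduces_on_parity:
  assumes "odd n \<Longrightarrow> transduces c us [] t us' v" "even n \<Longrightarrow> transduces c' us [] t us' v"
  shows "transduces (on_parity c c') us (enc_nat n) (Suc t + 2 * length (enc_nat n)) us' v"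
proof -
  have "transduces (on_parity c c') us (enc_nat n) (Suc t + 2 * length (enc_nat n)) us' (v @ [])"
    unfolding on_parity_def
    by (rule transduces_lookahead[OF enc_nat_not_Nil _ _ transduces_skip_nat])
       (use assms in \<open>simp_all add: hd_enc_nat_eq_2_iff\<close>)
  then show ?thesis by simp
qed

definition write_exponent :: com where
  "write_exponent = on_parity (emit (enc_nat 1)) (emit (enc_nat 0)) ;; move 1 1"

lemma transduces_write_exponent:
  "transduces write_exponent [(l, a # r), f] (enc_nat e) (7 * length (enc_nat e)) [(a # l, r), f]
      (enc_nat (e mod 2))"
proof -
  have parity: "transduces (on_parity (emit (enc_nat 1)) (emit (enc_nat 0))) [(l, a # r), f]
      (enc_nat e) (Suc 3 + 2 * length (enc_nat e)) [(l, a # r), f] (enc_nat (e mod 2))"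
    by (rule transduces_on_parity; rule transduces_eqI[OF transduces_emit])
       (auto simp: odd_iff_mod_2_eq_one enc_nat_small)
  have advance: "transduces (move 1 1) [(l, a # r), f] [] 1 [(a # l, r), f] []"
    by (rule transduces_counter) simp
  show ?thesis
    unfolding write_exponent_def
    by (rule transduces_eqI[OF transduces_Seq[OF parity advance]])
       (simp_all add: enc_nat_def)
qed

lemma transduces_write_exponents:
  assumes "length xs = length es"
  shows "transduces (foreach write_exponent) [(l, xs @ r), f] (enc_list enc_nat es)
      (9 * length (enc_list enc_nat es)) [(rev xs @ l, r), f] (enc_nats (map (\<lambda>e. e mod 2) es))"
proof -
  define \<sigma> where "\<sigma> es' = [(rev (take (length es') xs) @ l, drop (length es') xs @ r), f]"
      for es' :: "nat list"
  have "transduces (foreach write_exponent) (\<sigma> []) (enc_list enc_nat es)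
      ((7 + 2) * length (enc_list enc_nat es)) (\<sigma> es) (enc_nats (map (\<lambda>e. e mod 2) es))"
  proof (rule transduces_foreach[where V = "\<lambda>es. enc_nats (map (\<lambda>e. e mod 2) es)"
      and v = "\<lambda>_ e. enc_nat (e mod 2)"])
    fix ys e zs assume "es = ys @ e # zs"
    then have "length ys < length xs" using assms by simp
    then show "transduces write_exponent (\<sigma> ys) (enc_nat e) (7 * length (enc_nat e)) (\<sigma> (ys @ [e]))
        (enc_nat (e mod 2))"
      using transduces_write_exponent
      by (simp add: \<sigma>_def take_Suc_conv_app_nth flip: Cons_nth_drop_Suc)
  qed (simp_all add: enc_nat_not_Nil hd_enc_nat_neq_5)
  then show ?thesis
    by (simp add: \<sigma>_def assms)
qed

fun gate1_terms :: "nat \<Rightarrow> gate1 \<Rightarrow> terms" where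
  "gate1_terms f (Gate1 c es) = [(3 - f, []), (if odd c then f else 3 - f, map (\<lambda>e. e mod 2) es)]"

definition write_gate1 :: "nat \<Rightarrow> com" where
  "write_gate1 f = negate_reg ;; write_constant ;; on_parity negate_reg Skip ;;
     write_coeff ;; emit [4] ;; foreach write_exponent ;; finish_monomial ;; set_reg f"

lemma absorb_constant:
  fixes a b c n :: nat
  assumes "n > 0" "a + b \<le> c"
  shows "a + b * n \<le> c * n"
proof -
  have "a + b * n \<le> (a + b) * n"
    using assms(1) by (cases n) (simp_all add: algebra_simps)
  also have "\<dots> \<le> c * n"
    using assms(2) by (rule mult_right_mono) simp
  finally show ?thesis .
qed

lemma length_le_length_enc_list: "length xs \<le> length (enc_list enc_nat xs)"
  by (induction xs) (auto simp: enc_list_def enc_nat_def)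

lemma transduces_write_gate1:
  assumes f: "f \<in> {1, 2}" and "k + length (gate1_terms f g) \<le> L" "length (enc_gate1 g) \<le> L"
  shows "transduces (write_gate1 f) (work_tapes L k f) (enc_gate1 g)
      ((20 * L + 45) * length (enc_gate1 g)) (work_tapes L (k + length (gate1_terms f g)) f)
      (enc_terms L k (gate1_terms f g))"
proof -
  obtain c es where g: "g = Gate1 c es" by (cases g)
  have k: "Suc k < L" and es: "length es \<le> L"
    using assms(2,3) length_le_length_enc_list[of es] by (simp_all add: g)
  define xs ys where "xs = take (length es) (serial_tape L (Suc k))"
    and "ys = drop (length es) (serial_tape L (Suc k))"
  have split: "xs @ ys = serial_tape L (Suc k)"
    by (simp add: xs_def ys_def)
  have len: "length xs = length es" "length ys = L - length es"
    using k es by (simp_all add: xs_def ys_def serial_tape_def)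
  define f' where "f' = (if odd c then f else 3 - f)"
  have coeffs: "3 - f \<in> {1, 2}" "f' \<in> {1, 2}" "3 - (3 - f) = f"
    using f by (auto simp: f'_def)
  have free_term: "transduces write_constant (work_tapes L k (3 - f)) [] (10 * L + 15)
      [([0], xs @ ys @ [0]), ([], [3 - f])] (enc_terms L k [(3 - f, [])])"
    using transduces_write_constant[OF coeffs(1), of k L] k by (simp flip: split)
  have sign: "transduces (on_parity negate_reg Skip) [u, ([], [3 - f])] (enc_nat c)
      (Suc 1 + 2 * length (enc_nat c)) [u, ([], [f'])] []" for u
    using transduces_reg[of "\<lambda>a. 3 - a" u "3 - f"] transduces_Skip
    by (intro transduces_on_parity) (simp_all add: f'_def coeffs(3))
  define t where "t = 20 * L + 36 + 9 * length (enc_gate1 g)"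
  have "transduces (write_gate1 f) (work_tapes L k f) (enc_gate1 g) t
      (work_tapes L (k + length (gate1_terms f g)) f) (enc_terms L k (gate1_terms f g))"
    unfolding write_gate1_def
    by (rule transduces_eqI,
        (rule transduces_Seq transduces_reg free_term sign transduces_write_coeff coeffs
          transduces_emit transduces_write_exponents len transduces_finish_monomial split k)+)
       (simp_all add: g t_def f'_def len enc_numbered_monomial)
  moreover have "t \<le> (20 * L + 45) * length (enc_gate1 g)"
    unfolding t_def by (rule absorb_constant) (simp_all add: g enc_nat_def)
  ultimately show ?thesis by (blast intro: transduces_eqI)
qed

lemma transduces_foreach_numbered:
  fixes weight :: "'a list \<Rightarrow> nat"
  assumes out: "\<And>k. out k [] = []" "\<And>k u v. out k (u @ v) = out k u @ out (k + weight u) v"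
    and weight: "weight [] = 0" "\<And>u v. weight (u @ v) = weight u + weight v"
    and body: "\<And>x k. x \<in> set xs \<Longrightarrow> k + weight (U x) \<le> L \<Longrightarrow>
      transduces c (work_tapes L k f) (enc x) (C * length (enc x))
      (work_tapes L (k + weight (U x)) f) (out k (U x))"
    and enc: "\<And>x. x \<in> set xs \<Longrightarrow> enc x \<noteq> [] \<and> hd (enc x) \<noteq> 5"
    and bound: "k + weight (concat (map U xs)) \<le> L" and D: "C + 2 \<le> D"
  shows "transduces (foreach c) (work_tapes L k f) (enc_list enc xs) (D * length (enc_list enc xs))
           (work_tapes L (k + weight (concat (map U xs))) f) (out k (concat (map U xs)))"
proof -
  define W where "W ys = concat (map U ys)" for ys
  have "transduces (foreach c) (work_tapes L (k + weight (W [])) f) (enc_list enc xs)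
      ((C + 2) * length (enc_list enc xs)) (work_tapes L (k + weight (W xs)) f) (out k (W xs))"
  proof (rule transduces_foreach[where v = "\<lambda>ys y. out (k + weight (W ys)) (U y)"])
    fix ys y zs assume "xs = ys @ y # zs"
    then show "transduces c (work_tapes L (k + weight (W ys)) f) (enc y) (C * length (enc y))
        (work_tapes L (k + weight (W (ys @ [y]))) f) (out (k + weight (W ys)) (U y))"
      using body[of y "k + weight (W ys)"] bound by (simp add: W_def weight add.assoc)
  qed (simp_all add: W_def out enc)
  then have "transduces (foreach c) (work_tapes L k f) (enc_list enc xs)
      ((C + 2) * length (enc_list enc xs)) (work_tapes L (k + weight (W xs)) f) (out k (W xs))"
    by (simp add: W_def weight(1))
  then show ?thesis
    unfolding W_def by (rule transduces_eqI[OF _ refl mult_le_mono1[OF D] refl refl])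
qed

lemma length_enc_list_member: "x \<in> set xs \<Longrightarrow> length (enc x) \<le> length (enc_list enc xs)"
  by (induction xs) (auto simp: enc_list_def)

lemma transduces_foreach_gate1:
  assumes "f \<in> {1, 2}" "k + length (concat (map (gate1_terms f) gs)) \<le> L"
    "length (enc_list enc_gate1 gs) \<le> L"
  shows "transduces (foreach (write_gate1 f)) (work_tapes L k f) (enc_list enc_gate1 gs)
           ((20 * L + 47) * length (enc_list enc_gate1 gs))
           (work_tapes L (k + length (concat (map (gate1_terms f) gs))) f)
           (enc_terms L k (concat (map (gate1_terms f) gs)))"
proof (rule transduces_foreach_numbered)
  fix g j assume "g \<in> set gs" "j + length (gate1_terms f g) \<le> L"
  then show "transduces (write_gate1 f) (work_tapes L j f) (enc_gate1 g)
      ((20 * L + 45) * length (enc_gate1 g)) (work_tapes L (j + length (gate1_terms f g)) f)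
      (enc_terms L j (gate1_terms f g))"
    using assms(1,3) length_enc_list_member[of g gs enc_gate1]
    by (intro transduces_write_gate1) simp_all
next
  show "enc_gate1 g \<noteq> [] \<and> hd (enc_gate1 g) \<noteq> 5" for g
    by (cases g) (simp add: enc_nat_not_Nil hd_enc_nat_neq_5)
qed (simp_all add: numbered_poly_append assms(2))

text \<open>
  As \<open>2 ^ i\<close> is \<open>1\<close> or \<open>2\<close> modulo 3 depending on the parity of \<open>i\<close>, the sign of the coefficient
  alternates from digit to digit.
\<close>

definition digit_terms :: "nat \<Rightarrow> nat \<Rightarrow> terms" where
  "digit_terms f d = (if d = 2 then [(f, [])] else [])"

fun bits_terms :: "nat \<Rightarrow> nat list \<Rightarrow> terms" where
  "bits_terms f [] = []"
| "bits_terms f (d # ds) = digit_terms f d @ bits_terms (3 - f) ds"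

lemma bits_terms_snoc: "bits_terms f (ds @ [d]) =
    bits_terms f ds @ digit_terms (((-) 3 ^^ length ds) f) d"
  by (induction f ds rule: bits_terms.induct) (simp_all add: funpow_swap1)

lemma funpow_negate: "f \<in> {1, 2} \<Longrightarrow> ((-) 3 ^^ n) f \<in> {1, 2 :: nat}"
  by (induction n) auto

definition write_digit :: com where
  "write_digit = Cond 0 (\<lambda>a. a = 2) write_constant Skip ;; negate_reg ;; move 0 1"

lemma transduces_write_digit:
  assumes "f \<in> {1, 2}" "k + length (digit_terms f d) \<le> L"
  shows "transduces write_digit (work_tapes L k f) [d] (10 * L + 18)
           (work_tapes L (k + length (digit_terms f d)) (3 - f)) (enc_terms L k (digit_terms f d))"
proof -
  let ?u = "work_tapes L (k + length (digit_terms f d)) f"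
  have one: "transduces write_constant (work_tapes L k f) [] (10 * L + 15) ?u
      (enc_terms L k (digit_terms f d))" if "d = 2"
    using transduces_write_constant[OF assms(1), of k L] assms(2) that
    by (simp add: digit_terms_def)
  have zero: "transduces Skip (work_tapes L k f) [] (10 * L + 15) ?u
      (enc_terms L k (digit_terms f d))" if "d \<noteq> 2"
    using that by (intro transduces_eqI[OF transduces_Skip]) (simp_all add: digit_terms_def)
  have advance: "transduces (negate_reg ;; move 0 1) ?u [d] 2
      (work_tapes L (k + length (digit_terms f d)) (3 - f)) []"
    by (rule transduces_eqI[OF transduces_Seq[OF transduces_reg transduces_read]]) simp_all
  have "transduces write_digit (work_tapes L k f) [d] (Suc (10 * L + 15) + 2)
      (work_tapes L (k + length (digit_terms f d)) (3 - f)) (enc_terms L k (digit_terms f d) @ [])"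
    unfolding write_digit_def
    by (rule transduces_lookahead[OF _ _ _ advance]) (use one zero in simp_all)
  then show ?thesis
    by (rule transduces_eqI) simp_all
qed

lemma transduces_write_digits:
  assumes "f \<in> {1, 2}" "k + length (bits_terms f (bits n)) \<le> L"
  shows "transduces (read_until 3 write_digit) (work_tapes L k f) (enc_nat n)
      ((10 * L + 19) * length (enc_nat n) + 2)
      (work_tapes L (k + length (bits_terms f (bits n))) (((-) 3 ^^ length (bits n)) f))
      (enc_terms L k (bits_terms f (bits n)))"
proof -
  define \<sigma> where "\<sigma> ds = work_tapes L (k + length (bits_terms f ds)) (((-) 3 ^^ length ds) f)"
      for ds
  have "transduces (read_until 3 write_digit) (\<sigma> []) (concat (map (\<lambda>d. [d]) (bits n)) @ [3])
      (Suc (10 * L + 18) * length (concat (map (\<lambda>d. [d]) (bits n))) + 2) (\<sigma> (bits n))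
      (enc_terms L k (bits_terms f (bits n)))"
  proof (rule transduces_read_until[where v = "\<lambda>ds d. enc_terms L (k + length (bits_terms f ds))
        (digit_terms (((-) 3 ^^ length ds) f) d)"])
    fix ds d ds' assume split: "bits n = ds @ d # ds'"
    have "bits_terms f (bits n) =
        bits_terms f (ds @ [d]) @ bits_terms (((-) 3 ^^ length (ds @ [d])) f) ds'"
      unfolding split by (induction f ds rule: bits_terms.induct) (simp_all add: funpow_swap1)
    then have "k + length (bits_terms f (ds @ [d])) \<le> L"
      using assms(2) by simp
    then show "transduces write_digit (\<sigma> ds) [d] ((10 * L + 18) * length [d]) (\<sigma> (ds @ [d]))
        (enc_terms L (k + length (bits_terms f ds)) (digit_terms (((-) 3 ^^ length ds) f) d))"
      using transduces_write_digit[OF funpow_negate[OF assms(1)], of "k + length (bits_terms f ds)"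
          "length ds" d L]
      by (simp add: \<sigma>_def bits_terms_snoc add.assoc)
  qed (use set_bits[of n] in \<open>auto simp: bits_terms_snoc numbered_poly_append\<close>)
  then have "transduces (read_until 3 write_digit) (work_tapes L k f) (enc_nat n)
      (Suc (10 * L + 18) * length (bits n) + 2) (\<sigma> (bits n))
      (enc_terms L k (bits_terms f (bits n)))"
    by (simp add: \<sigma>_def enc_nat_def)
  then show ?thesis
    by (rule transduces_eqI) (simp_all add: \<sigma>_def enc_nat_def algebra_simps)
qed

fun gate2_terms :: "nat \<Rightarrow> gate2 \<Rightarrow> terms" where
  "gate2_terms f (Gate2 c gs) = bits_terms f (bits c) @ concat (map (gate1_terms f) gs)"

text \<open>The empty polynomial contributes the summand \<open>1\<close> of \<open>Mod 3 z = 1 + \<alpha>\<^sup>z + \<alpha>\<^bsup>2z\<^esup>\<close>.\<close>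

definition gate2_system :: "nat \<Rightarrow> gate2 \<Rightarrow> terms list" where
  "gate2_system f g = (if f = 1 then [[]] else []) @ [gate2_terms f g]"

definition write_gate2 :: "nat \<Rightarrow> com" where
  "write_gate2 f = emit (if f = 1 then [4, 5, 4] else [4]) ;; read_until 3 write_digit ;;
     set_reg f ;; foreach (write_gate1 f) ;; emit [5]"

lemma transduces_write_gate2:
  assumes f: "f \<in> {1, 2}" and terms: "k + length (gate2_terms f g) \<le> L"
    and enc: "length (enc_gate2 g) \<le> L"
  shows "transduces (write_gate2 f) (work_tapes L k f) (enc_gate2 g)
      ((20 * L + 56) * length (enc_gate2 g)) (work_tapes L (k + length (gate2_terms f g)) f)
      (enc_system L k (gate2_system f g))"
proof -
  obtain c gs where g: "g = Gate2 c gs" by (cases g)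
  let ?k = "k + length (bits_terms f (bits c))"
  have header: "transduces (emit (if f = 1 then [4, 5, 4] else [4])) (work_tapes L k f) [] 4
      (work_tapes L k f) (enc_system L k (if f = 1 then [[]] else []) @ [4])"
    by (rule transduces_eqI[OF transduces_emit]) (simp_all add: enc_list_def)
  have digits: "transduces (read_until 3 write_digit) (work_tapes L k f) (enc_nat c)
      ((10 * L + 19) * length (enc_nat c) + 2) (work_tapes L ?k (((-) 3 ^^ length (bits c)) f))
      (enc_terms L k (bits_terms f (bits c)))"
    by (rule transduces_write_digits) (use f terms g in simp_all)
  have gates: "transduces (foreach (write_gate1 f)) (work_tapes L ?k f) (enc_list enc_gate1 gs)
      ((20 * L + 47) * length (enc_list enc_gate1 gs))
      (work_tapes L (?k + length (concat (map (gate1_terms f) gs))) f)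
      (enc_terms L ?k (concat (map (gate1_terms f) gs)))"
    by (rule transduces_foreach_gate1) (use f terms enc g in simp_all)
  define t where "t = 9 + (20 * L + 47) * length (enc_gate2 g)"
  have digits_cost: "(10 * L + 19) * length (enc_nat c) \<le> (20 * L + 47) * length (enc_nat c)"
    by (rule mult_right_mono) simp_all
  have "transduces (write_gate2 f) (work_tapes L k f) (enc_gate2 g) t
      (work_tapes L (k + length (gate2_terms f g)) f) (enc_system L k (gate2_system f g))"
    unfolding write_gate2_def
    by (rule transduces_eqI, (rule transduces_Seq header digits transduces_reg gates
        transduces_emit)+)
       (use digits_cost in \<open>simp_all add: g t_def gate2_system_def numbered_poly_append enc_list_def
          add.assoc add_mult_distrib2\<close>)
  moreover have "t \<le> (20 * L + 56) * length (enc_gate2 g)"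
    unfolding t_def by (rule absorb_constant) (simp_all add: g enc_nat_def)
  ultimately show ?thesis by (blast intro: transduces_eqI)
qed

lemma concat_gate2_systems: "concat (concat (map (gate2_system f) gs)) =
    concat (map (gate2_terms f) gs)"
  by (induction gs) (simp_all add: gate2_system_def)

lemma transduces_foreach_gate2:
  assumes "f \<in> {1, 2}" "k + length (concat (map (gate2_terms f) gs)) \<le> L"
    "length (enc_list enc_gate2 gs) \<le> L"
  shows "transduces (foreach (write_gate2 f)) (work_tapes L k f) (enc_list enc_gate2 gs)
           ((20 * L + 58) * length (enc_list enc_gate2 gs))
           (work_tapes L (k + length (concat (map (gate2_terms f) gs))) f)
           (enc_system L k (concat (map (gate2_system f) gs)))"
  unfolding concat_gate2_systems[symmetric]
proof (rule transduces_foreach_numbered)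
  fix g j assume "g \<in> set gs" "j + length (concat (gate2_system f g)) \<le> L"
  moreover have "concat (gate2_system f g) = gate2_terms f g"
    by (simp add: gate2_system_def)
  ultimately show "transduces (write_gate2 f) (work_tapes L j f) (enc_gate2 g)
      ((20 * L + 56) * length (enc_gate2 g))
      (work_tapes L (j + length (concat (gate2_system f g))) f) (enc_system L j (gate2_system f g))"
    using assms(1,3) length_enc_list_member[of g gs enc_gate2] transduces_write_gate2 by simp
next
  show "enc_gate2 g \<noteq> [] \<and> hd (enc_gate2 g) \<noteq> 5" for g
    by (cases g) (simp add: enc_nat_not_Nil hd_enc_nat_neq_5)
qed (simp_all add: numbered_system_append concat_gate2_systems assms(2))

fun circuit_system :: "nat \<Rightarrow> circuit \<Rightarrow> terms list" where
  "circuit_system f (Circuit n c gs) =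
      (if f = 1 \<and> odd c then [[]] else []) @ concat (map (gate2_system f) gs)"

lemma concat_circuit_system: "concat (circuit_system f (Circuit n c gs)) =
    concat (map (gate2_terms f) gs)"
  by (simp add: concat_gate2_systems)

definition write_circuit :: "nat \<Rightarrow> com" where
  "write_circuit f = set_reg f ;; skip_nat ;; on_parity (emit (if f = 1 then [4, 5] else [])) Skip
      ;; foreach (write_gate2 f)"

lemma transduces_write_circuit:
  assumes f: "f \<in> {1, 2}" and terms: "k + length (concat (circuit_system f C)) \<le> L"
    and enc: "length (enc_circuit C) \<le> L"
  shows "transduces (write_circuit f) (work_tapes L k f0) (enc_circuit C)
      ((20 * L + 63) * length (enc_circuit C))
      (work_tapes L (k + length (concat (circuit_system f C))) f)
      (enc_system L k (circuit_system f C))"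
proof -
  obtain n c gs where C: "C = Circuit n c gs" by (cases C)
  have header: "transduces (on_parity (emit (if f = 1 then [4, 5] else [])) Skip) (work_tapes L k f)
      (enc_nat c) (Suc 3 + 2 * length (enc_nat c)) (work_tapes L k f)
      (enc_system L k (if f = 1 \<and> odd c then [[]] else []))"
    by (rule transduces_on_parity; intro transduces_eqI[OF transduces_emit]
        transduces_eqI[OF transduces_Skip])
       (simp_all add: enc_list_def)
  have gates: "transduces (foreach (write_gate2 f)) (work_tapes L k f) (enc_list enc_gate2 gs)
      ((20 * L + 58) * length (enc_list enc_gate2 gs))
      (work_tapes L (k + length (concat (circuit_system f C))) f)
      (enc_system L k (concat (map (gate2_system f) gs)))"
    unfolding C concat_circuit_system
    by (rule transduces_foreach_gate2) (use f terms[unfolded C concat_circuit_system] enc C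
        in simp_all)
  have skip_cost: "2 * length (enc_nat m) \<le> (20 * L + 58) * length (enc_nat m)" for m
    by (rule mult_right_mono) simp_all
  define t where "t = 5 + (20 * L + 58) * length (enc_circuit C)"
  have "transduces (write_circuit f) (work_tapes L k f0) (enc_circuit C) t
      (work_tapes L (k + length (concat (circuit_system f C))) f)
      (enc_system L k (circuit_system f C))"
    unfolding write_circuit_def
    by (rule transduces_eqI, (rule transduces_Seq transduces_reg transduces_skip_nat header gates)+)
       (simp_all add: C t_def add_mult_distrib2 numbered_system_append,
         use skip_cost[of n] skip_cost[of c] in linarith)
  moreover have "t \<le> (20 * L + 63) * length (enc_circuit C)"
    unfolding t_def by (rule absorb_constant) (simp_all add: C enc_nat_def)
  ultimately show ?thesis by (blast intro: transduces_eqI)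
qed

section \<open>The reduction program\<close>

lemma bits_Suc:
  "bits (Suc n) = map (\<lambda>_. 1) (takeWhile (\<lambda>a. a = 2) (bits n)) @
      2 # tl (dropWhile (\<lambda>a. a = 2) (bits n))"
proof (induction n rule: nat_bit_induct)
  case zero
  then show ?case using bits_double_Suc[of 0] by simp
next
  case (even n)
  then show ?case by (simp add: bits_double bits_double_Suc)
next
  case (odd n)
  then show ?case using bits_double[of "Suc n"] by (simp add: bits_double_Suc)
qed

definition increment :: "nat \<Rightarrow> com" where
  "increment i = While i (\<lambda>a. a = 2) (Act i (\<lambda>_. 1) 1) ;; Act i (\<lambda>_. 2) 0 ;; rewind i"

lemma exec_increment:
  assumes i: "i < length s" and s: "s ! i = ([0], bits n)"
  shows "exec (increment i) s (4 * n + 5) (s[i := ([0], bits (Suc n))])"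
proof -
  define ones rest where "ones = takeWhile (\<lambda>a. a = 2) (bits n)"
    and "rest = dropWhile (\<lambda>a. a = 2) (bits n)"
  have split: "bits n = ones @ rest"
    by (simp add: ones_def rest_def)
  have len: "length ones \<le> n"
    using length_bits_le[of n] by (simp add: split)
  have rest: "nth_default 0 rest 0 \<noteq> 2"
    using dropWhile_eq_Cons_conv[of "\<lambda>a. a = 2" "bits n"] by (cases rest) (auto simp flip: rest_def)
  define \<sigma> where "\<sigma> xs ys = s[i := (rev (map (\<lambda>_. 1) xs) @ [0], ys @ rest)]" for xs ys :: "nat list"
  have carry: "exec (While i (\<lambda>a. a = 2) (Act i (\<lambda>_. 1) 1)) (\<sigma> [] ones) (Suc (\<Sum>a\<leftarrow>ones. Suc 1))
      (\<sigma> ones [])"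
  proof (rule exec_While_list)
    fix xs a ys
    show "exec (Act i (\<lambda>_. 1) 1) (\<sigma> xs (a # ys)) 1 (\<sigma> (xs @ [a]) ys)"
      by (rule exec_ActI) (use i in \<open>simp_all add: \<sigma>_def\<close>)
    assume "ones = xs @ a # ys"
    then have "a \<in> set (takeWhile (\<lambda>a. a = 2) (bits n))" by (simp flip: ones_def)
    then show "zscan (\<sigma> xs (a # ys) ! i) = 2"
      using i by (auto simp: \<sigma>_def dest: set_takeWhileD)
  qed (use i rest in \<open>simp_all add: \<sigma>_def\<close>)
  have start: "\<sigma> [] ones = s"
    using list_update_id[of s i] s by (simp add: \<sigma>_def split)
  have set: "exec (Act i (\<lambda>_. 2) 0) (\<sigma> ones []) 1
      (s[i := (rev (map (\<lambda>_. 1) ones) @ [0], 2 # tl rest)])"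
    by (rule exec_ActI) (use i in \<open>simp_all add: \<sigma>_def\<close>)
  have return: "exec (rewind i) (s[i := (rev (map (\<lambda>_. 1) ones) @ [0], 2 # tl rest)])
      (2 * length ones + 3) (s[i := ([0], map (\<lambda>_. 1) ones @ 2 # tl rest)])"
    using exec_rewind[of i "s[i := (rev (map (\<lambda>_. 1) ones) @ [0], 2 # tl rest)]" "map (\<lambda>_. 1) ones"
        "[0]"] i
    by auto
  show ?thesis
    unfolding increment_def
    by (rule exec_eqI[OF exec.Seq[OF carry[unfolded start] exec.Seq[OF set return]]])
       (use len in \<open>simp_all add: sum_list_triv bits_Suc ones_def rest_def\<close>)
qed

fun repeat :: "nat \<Rightarrow> com \<Rightarrow> com" where
  "repeat 0 c = Skip"
| "repeat (Suc n) c = c ;; repeat n c"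

lemma exec_repeat:
  "(\<And>j. j < n \<Longrightarrow> exec c (\<sigma> j) t (\<sigma> (Suc j))) \<Longrightarrow> exec (repeat n c) (\<sigma> 0) (n * t + 1) (\<sigma> n)"
proof (induction n arbitrary: \<sigma>)
  case 0
  then show ?case using exec.Skip by simp
next
  case (Suc n)
  have "exec (repeat n c) (\<sigma> (Suc 0)) (n * t + 1) (\<sigma> (Suc n))"
    by (rule Suc.IH[of "\<lambda>j. \<sigma> (Suc j)"]) (use Suc.prems in simp)
  from exec.Seq[OF Suc.prems this] show ?case by (simp add: add.assoc)
qed

text \<open>
  For an input of length \<open>N\<close>, the counter on tape 1 has \<open>2 * N\<close> cells, and the number \<open>4 * N\<close> of
  variables is accumulated on tape 3.
\<close>

definition count_symbol :: com where
  "count_symbol = repeat 2 (Act 1 (\<lambda>_. 1) 1) ;; repeat 4 (increment 3) ;; move 0 1"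

lemma exec_count_symbol:
  assumes "4 * Suc n \<le> B"
  shows "exec count_symbol [(l, a # x), (replicate (2 * n) 1, []), f, ([0], bits (4 * n))]
      (16 * B + 25) [(a # l, x), (replicate (2 * Suc n) 1, []), f, ([0], bits (4 * Suc n))]"
proof -
  let ?i = "(l, a # x)"
  have mark: "exec (repeat 2 (Act 1 (\<lambda>_. 1) 1)) [?i, (replicate (2 * n + 0) 1, []), f, w]
      (2 * 1 + 1) [?i, (replicate (2 * n + 2) 1, []), f, w]" for w
    by (rule exec_repeat[of 2 _ "\<lambda>j. [?i, (replicate (2 * n + j) 1, []), f, w]"])
       (rule exec_ActI; simp)
  have count: "exec (repeat 4 (increment 3)) [?i, u, f, ([0], bits (4 * n + 0))]
      (4 * (4 * B + 5) + 1) [?i, u, f, ([0], bits (4 * n + 4))]" for u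
  proof (rule exec_repeat[of 4 _ "\<lambda>j. [?i, u, f, ([0], bits (4 * n + j))]"])
    fix j :: nat assume "j < 4"
    then show "exec (increment 3) [?i, u, f, ([0], bits (4 * n + j))] (4 * B + 5)
        [?i, u, f, ([0], bits (4 * n + Suc j))]"
      by (intro exec_eqI[OF exec_increment[of _ _ "4 * n + j"]])
         (use assms in \<open>simp_all add: numeral_3_eq_3\<close>)
  qed
  have advance: "exec (move 0 1) [?i, u, f, w] 1 [(a # l, x), u, f, w]" for u w
    by (rule exec_ActI) simp_all
  show ?thesis
    unfolding count_symbol_def
    by (rule exec_eqI[OF exec.Seq[OF mark[unfolded add_0_right]
        exec.Seq[OF count[unfolded add_0_right] advance]]])
       (simp_all add: add.commute)
qed

lemma exec_count_input:
  assumes "0 \<notin> set w" "N = length w"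
  shows "exec (While 0 (\<lambda>a. a \<noteq> 0) count_symbol) [([], w), ([], []), f, ([0], [])]
      (64 * N * N + 26 * N + 1) [(rev w, []), (replicate (2 * N) 1, []), f, ([0], bits (4 * N))]"
proof -
  define \<sigma> where "\<sigma> xs ys = [(rev xs, ys), (replicate (2 * length xs) 1, []), f,
      ([0], bits (4 * length xs))]" for xs ys :: "nat list"
  have "exec (While 0 (\<lambda>a. a \<noteq> 0) count_symbol) (\<sigma> [] w) (Suc (\<Sum>a\<leftarrow>w. Suc (16 * (4 * N) + 25)))
      (\<sigma> w [])"
  proof (rule exec_While_list)
    fix xs a ys assume "w = xs @ a # ys"
    then have "4 * Suc (length xs) \<le> 4 * N" using assms(2) by simp
    from exec_count_symbol[OF this]
    show "exec count_symbol (\<sigma> xs (a # ys)) (16 * (4 * N) + 25) (\<sigma> (xs @ [a]) ys)"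
      by (simp add: \<sigma>_def)
  qed (use assms(1) in \<open>auto simp: \<sigma>_def\<close>)
  then show ?thesis
    by (simp add: \<sigma>_def sum_list_triv assms(2) algebra_simps)
qed

definition init_tapes :: com where
  "init_tapes = set_reg 1 ;; move 3 1 ;; While 0 (\<lambda>a. a \<noteq> 0) count_symbol ;;
     While 3 (\<lambda>a. a \<noteq> 0) (move 3 1) ;; emit [3, 4] ;; rewind 0 ;; rewind 1"

lemma exec_init_tapes:
  assumes "0 \<notin> set w" "N = length w"
  shows "exec init_tapes [([], w), ([], []), ([], []), ([], [])] (64 * N * N + 40 * N + 13)
     (([0], w @ [0]) # work_tapes (2 * N) 0 1 @ [(rev (enc_nat (4 * N) @ [4]) @ [0], [])])"
proof -
  let ?f = "([], [1])"
  have reg: "exec (set_reg 1) [i, u, ([], []), b] 1 [i, u, ?f, b]" for i u b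
    by (rule exec_ActI) (simp_all add: numeral_2_eq_2)
  have fence: "exec (move 3 1) [i, u, f, ([], [])] 1 [i, u, f, ([0], [])]" for i u f
    by (rule exec_ActI) (simp_all add: numeral_3_eq_3)
  have digits: "exec (While 3 (\<lambda>a. a \<noteq> 0) (move 3 1)) [i, u, f, ([0], bits (4 * N))] (8 * N + 1)
      [i, u, f, (rev (bits (4 * N)) @ [0], [])]" for i u f
    by (rule exec_eqI[OF exec_While_move_right[of _ _ "[0]" "bits (4 * N)" "[]"]])
       (use length_bits_le[of "4 * N"] set_bits[of "4 * N"] in \<open>auto simp: numeral_3_eq_3\<close>)
  have bracket: "exec (emit [3, 4]) [i, u, f, (b, [])] 3 [i, u, f, (4 # 3 # b, [])]" for i u f b
    using transduces_exec[OF transduces_emit[of "[3, 4]"], of "fst i" "snd i"]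
    by (simp add: numeral_3_eq_3)
  have input: "exec (rewind 0) [(rev w, []), u, f, b] (2 * N + 3) [([0], w @ [0]), u, f, b]"
      for u f b
    using exec_rewind[of 0 "[(rev w, []), u, f, b]" w "[]"] assms by simp
  have counter: "exec (rewind 1) [i, (replicate (2 * N) 1, []), f, b] (4 * N + 3)
      [i, ([0], serial_tape (2 * N) 0 @ [0]), f, b]" for i f b
    using exec_rewind[of 1 "[i, (replicate (2 * N) 1, []), f, b]" "replicate (2 * N) 1" "[]" "[]"]
    by (auto simp: serial_tape_def)
  show ?thesis
    unfolding init_tapes_def
    by (rule exec_eqI, (rule exec.Seq reg fence exec_count_input[OF assms] digits bracket input
        counter)+)
       (simp_all add: algebra_simps enc_nat_def)
qed

lemma set_enc_nat: "set (enc_nat n) \<subseteq> {1..<6}"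
  using set_bits[of n] by (auto simp: enc_nat_def)

lemma set_enc_list: "(\<And>x. x \<in> set xs \<Longrightarrow> set (enc x) \<subseteq> {1..<6}) \<Longrightarrow> set (enc_list enc xs) \<subseteq> {1..<6}"
  by (fastforce simp: enc_list_def)

lemma set_enc_gate1: "set (enc_gate1 g) \<subseteq> {1..<6}"
  by (cases g) (simp add: set_enc_nat set_enc_list del: One_nat_def)

lemma set_enc_gate2: "set (enc_gate2 g) \<subseteq> {1..<6}"
  by (cases g) (simp add: set_enc_nat set_enc_list set_enc_gate1 del: One_nat_def)

lemma set_enc_circuit: "set (enc_circuit C) \<subseteq> {1..<6}"
  by (cases C) (simp add: set_enc_nat set_enc_list set_enc_gate2 del: One_nat_def)

lemma set_enc_monomial: "set (enc_monomial m) \<subseteq> {1..<6}"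
  by (cases m) (simp add: enc_monomial_def set_enc_nat set_enc_list del: One_nat_def)

lemma set_enc_poly_system: "set (enc_poly_system S) \<subseteq> {1..<6}"
  by (cases S) (simp add: enc_poly_system_def set_enc_nat set_enc_list set_enc_monomial
      del: One_nat_def)

lemma length_concat_map_le:
  "(\<And>x. x \<in> set xs \<Longrightarrow> length (f x) \<le> length (g x)) \<Longrightarrow>
      length (concat (map f xs)) \<le> length (concat (map g xs))"
  by (induction xs) (auto intro: add_mono)

lemma length_gate1_terms: "length (gate1_terms f g) \<le> length (enc_gate1 g)"
  by (cases g) (simp add: enc_list_def)

lemma length_bits_terms: "length (bits_terms f ds) \<le> length ds"
  by (induction f ds rule: bits_terms.induct) (simp_all add: digit_terms_def)

lemma length_gate2_terms: "length (gate2_terms f g) \<le> length (enc_gate2 g)"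
proof (cases g)
  case (Gate2 c gs)
  have "length (concat (map (gate1_terms f) gs)) \<le> length (concat (map enc_gate1 gs))"
    by (rule length_concat_map_le) (rule length_gate1_terms)
  then show ?thesis
    using length_bits_terms[of f "bits c"] by (simp add: Gate2 enc_list_def enc_nat_def)
qed

lemma length_circuit_system: "length (concat (circuit_system f C)) \<le> length (enc_circuit C)"
proof (cases C)
  case (Circuit n c gs)
  have "length (concat (map (gate2_terms f) gs)) \<le> length (concat (map enc_gate2 gs))"
    by (rule length_concat_map_le) (rule length_gate2_terms)
  then show ?thesis
    unfolding Circuit concat_circuit_system by (simp add: enc_list_def)
qed

definition reduced_system :: "circuit \<Rightarrow> terms list" where
  "reduced_system C = circuit_system 1 C @ circuit_system 2 C"

definition reduction :: "circuit \<Rightarrow> nat \<times> expanded_poly list" where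
  "reduction C = (let N = length (enc_circuit C) in
      (4 * N, numbered_system (2 * N) 0 (reduced_system C)))"

lemma length_reduced_system: "length (concat (reduced_system C)) \<le> 2 * length (enc_circuit C)"
  using length_circuit_system[of 1 C] length_circuit_system[of 2 C]
  by (simp add: reduced_system_def)

definition write_system :: com where
  "write_system = init_tapes ;; write_circuit 1 ;; rewind 0 ;; write_circuit 2 ;; emit [5]"

definition reduction_com :: com where
  "reduction_com = write_system ;; rewind 3"

lemma exec_write_system:
  assumes N: "N = length (enc_circuit C)"
  shows "\<exists>i u f. exec write_system
     [([], enc_circuit C), ([], []), ([], []), ([], [])] (144 * N * N + 168 * N + 18)
     [i, u, f, (rev (enc_poly_system (reduction C)) @ [0], [])]"
proof -
  let ?w = "enc_circuit C" and ?L = "2 * N"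
  define k where "k f = length (concat (circuit_system f C))" for f
  have k_le: "k f \<le> N" for f
    using length_circuit_system[of f C] by (simp add: k_def N)
  have nonblank: "0 \<notin> set ?w" using set_enc_circuit[of C] by auto
  have circuit: "exec (write_circuit f) (([0], ?w @ [0]) # work_tapes ?L k0 f0 @ [(b, [])])
      ((20 * ?L + 63) * N) ((rev ?w @ [0], [0]) # work_tapes ?L (k0 + k f) f @
        [(rev (enc_system ?L k0 (circuit_system f C)) @ b, [])])"
    if "f \<in> {1, 2}" "k0 \<le> N" for f k0 f0 b
    unfolding k_def N
    by (intro transduces_exec transduces_write_circuit)
       (use that k_le[of f] in \<open>simp_all add: k_def N\<close>)
  have rewound: "exec (rewind 0) ((rev ?w @ [0], [0]) # s) (2 * N + 3) (([0], ?w @ [0]) # s)" for s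
    using exec_rewind[of 0 "(rev ?w @ [0], [0]) # s" ?w "[0]"] nonblank by (simp add: N)
  have bracket: "exec (emit [5]) (i # work_tapes L k f @ [(b, [])]) 2
      (i # work_tapes L k f @ [(5 # b, [])])" for i L k f b
    using transduces_exec[OF transduces_emit[of "[5]"], of "fst i" "snd i"]
    by (simp add: numeral_2_eq_2)
  have "exec write_system [([], ?w), ([], []), ([], []), ([], [])] (144 * N * N + 168 * N + 18)
      ((rev ?w @ [0], [0]) # work_tapes ?L (k 1 + k 2) 2 @
        [(rev (enc_poly_system (reduction C)) @ [0], [])])"
    unfolding write_system_def
    by (rule exec_eqI[OF exec.Seq[OF exec_init_tapes[OF nonblank N]
        exec.Seq[OF circuit exec.Seq[OF rewound exec.Seq[OF circuit bracket]]]]])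
       (simp_all add: k_le[unfolded k_def] algebra_simps enc_poly_system_def reduction_def
          reduced_system_def Let_def enc_list_def numbered_system_append k_def flip: N)
  then show ?thesis unfolding append.simps by blast
qed

lemma exec_reduction:
  assumes N: "N = length (enc_circuit C)"
  shows "\<exists>i u f. exec reduction_com [([], enc_circuit C), ([], []), ([], []), ([], [])]
      (432 * N * N + 504 * N + 57) [i, u, f, ([0], enc_poly_system (reduction C) @ [0])]"
proof -
  let ?y = "enc_poly_system (reduction C)" and ?t = "144 * N * N + 168 * N + 18"
  obtain i u f where written: "exec write_system
      [([], enc_circuit C), ([], []), ([], []), ([], [])] ?t [i, u, f, (rev ?y @ [0], [])]"
    using exec_write_system[OF N] by blast
  have "length ?y \<le> ?t"
    using exec_length_left[OF written, of 3] by (simp add: numeral_3_eq_3)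
  moreover have "0 \<notin> set ?y" using set_enc_poly_system[of "reduction C"] by auto
  ultimately have "exec (rewind 3) [i, u, f, (rev ?y @ [0], [])] (2 * ?t + 3)
      [i, u, f, ([0], ?y @ [0])]"
    by (intro exec_eqI[OF exec_rewind[of _ _ ?y "[0]" "[]"]]) (simp_all add: numeral_3_eq_3)
  from exec.Seq[OF written this]
  have "exec reduction_com [([], enc_circuit C), ([], []), ([], []), ([], [])]
      (432 * N * N + 504 * N + 57) [i, u, f, ([0], ?y @ [0])]"
    unfolding reduction_com_def by (rule exec_eqI) simp_all
  then show ?thesis by blast
qed

lemma wf_emit: "3 < K \<Longrightarrow> set w \<subseteq> {..<S} \<Longrightarrow> wf_com K S (emit w)"
  by (induction w) auto

lemma wf_repeat: "wf_com K S c \<Longrightarrow> wf_com K S (repeat n c)"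
  by (induction n) simp_all

lemma wf_reduction_com: "wf_com 4 6 reduction_com"
  by (auto simp: reduction_com_def write_system_def init_tapes_def count_symbol_def increment_def
      rewind_def write_circuit_def write_gate2_def write_gate1_def write_digit_def
      write_constant_def write_coeff_def finish_monomial_def pad_exponents_def write_serial_def
      sweep_def skip_nat_def on_parity_def write_exponent_def foreach_def
      read_until_def enc_nat_small wf_emit wf_repeat)

lemma reduction_computable:
  "computes_within (machine 4 6 reduction_com) (enc_circuit C) (enc_poly_system (reduction C))
     (poly [:57, 504, 432:] (length (enc_circuit C)))"
proof -
  obtain i u f where exec: "exec reduction_com [([], enc_circuit C), ([], []), ([], []), ([], [])]
      (poly [:57, 504, 432:] (length (enc_circuit C)))
      [i, u, f, ([0], enc_poly_system (reduction C) @ [0])]"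
    using exec_reduction[OF refl] by (fastforce simp: algebra_simps)
  show ?thesis
  proof (rule machine_computes[OF _ wf_reduction_com])
    show "exec reduction_com (([], enc_circuit C) # replicate (4 - 1) ([], []))
        (poly [:57, 504, 432:] (length (enc_circuit C)))
        [i, u, f, ([0], enc_poly_system (reduction C) @ [0])]"
      using exec by (simp add: numeral_3_eq_3)
  qed (use set_enc_poly_system[of "reduction C"] set_enc_circuit[of C] in auto)
qed

section \<open>Correctness of the reduction\<close>

definition monomial_value :: "int list \<Rightarrow> nat \<times> nat list \<Rightarrow> int" where
  "monomial_value a m = int (fst m) * (\<Prod>i<length (snd m). a ! i ^ (snd m ! i))"

abbreviation terms_value :: "int list \<Rightarrow> terms \<Rightarrow> int" where
  "terms_value a ms \<equiv> (\<Sum>m\<leftarrow>ms. monomial_value a m)"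

lemma eval_expanded_eq: "eval_expanded p a = terms_value a p mod 3"
  by (simp add: eval_expanded_def monomial_value_def case_prod_unfold)

lemma monomial_value_append_even:
  assumes "\<forall>e\<in>set w. even e" and "length (v @ w) \<le> length a" "set a \<subseteq> {-1, 1}"
  shows "monomial_value a (c, v @ w) = monomial_value a (c, v)"
proof -
  have "a ! i ^ ((v @ w) ! i) = 1" if "i \<in> {length v..<length (v @ w)}" for i
  proof -
    have "a ! i \<in> set a" using that assms(2) by simp
    then have "a ! i \<in> {-1, 1}" using assms(3) by blast
    moreover have "(v @ w) ! i \<in> set w" using that by (auto simp: nth_append intro!: nth_mem)
    then have "even ((v @ w) ! i)" using assms(1) by blast
    ultimately show ?thesis by auto
  qed
  then have "(\<Prod>i\<in>{length v..<length (v @ w)}. a ! i ^ ((v @ w) ! i)) = 1"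
    by (rule prod.neutral[OF ballI])
  then have "(\<Prod>i<length (v @ w). a ! i ^ ((v @ w) ! i)) = (\<Prod>i<length v. a ! i ^ ((v @ w) ! i))"
    using prod.atLeastLessThan_concat[of 0 "length v" "length (v @ w)" "\<lambda>i. a ! i ^ ((v @ w) ! i)"]
    by (simp add: atLeast0LessThan)
  also have "\<dots> = (\<Prod>i<length v. a ! i ^ (v ! i))"
    by (rule prod.cong) (simp_all add: nth_append)
  finally show ?thesis by (simp add: monomial_value_def)
qed

definition admissible :: "nat \<Rightarrow> nat \<times> nat list \<Rightarrow> bool" where
  "admissible L m \<longleftrightarrow> fst m \<in> {1, 2} \<and> length (snd m) \<le> L \<and> set (snd m) \<subseteq> {0, 1}"

lemma in_set_numbered_polyE:
  assumes "p \<in> set (numbered_poly L k ms)"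
  obtains i m where "k \<le> i" "i < k + length ms" "m \<in> set ms" "p = numbered_monomial L i m"
proof -
  have "\<exists>i m. k \<le> i \<and> i < k + length ms \<and> m \<in> set ms \<and> p = numbered_monomial L i m"
    using assms
  proof (induction ms arbitrary: k)
    case (Cons m ms)
    then consider (head) "p = numbered_monomial L k m"
      | (tail) "p \<in> set (numbered_poly L (Suc k) ms)"
      by auto
    then show ?case
    proof cases
      case head
      then show ?thesis by (intro exI[of _ k] exI[of _ m]) simp
    next
      case tail
      then obtain i m' where "Suc k \<le> i" "i < Suc k + length ms" "m' \<in> set ms"
        "p = numbered_monomial L i m'"
        using Cons.IH by blast
      then show ?thesis by (intro exI[of _ i] exI[of _ m']) simp
    qed
  qed simp
  then show ?thesis using that by blast
qed

lemma serial_number_unique: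
  assumes "snd (numbered_monomial L i m) = snd (numbered_monomial L j m')" "length (snd m) \<le> L"
    "length (snd m') \<le> L"
  shows "i = j"
proof -
  have "drop L (snd (numbered_monomial L i m)) = replicate i 2 @ replicate (L - i) 0"
    "drop L (snd (numbered_monomial L j m')) = replicate j 2 @ replicate (L - j) 0"
    using assms(2,3) by (simp_all add: numbered_monomial_def)
  then have "filter ((=) 2) (replicate i (2::nat) @ replicate (L - i) 0) =
      filter ((=) 2) (replicate j (2::nat) @ replicate (L - j) 0)"
    using assms(1) by simp
  then show ?thesis by simp
qed

lemma distinct_numbered_poly:
  "\<forall>m\<in>set ms. admissible L m \<Longrightarrow> distinct (map snd (numbered_poly L k ms))"
proof (induction ms arbitrary: k)
  case (Cons m ms)
  have "snd (numbered_monomial L k m) \<noteq> snd p" if p: "p \<in> set (numbered_poly L (Suc k) ms)" for p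
  proof -
    obtain i m' where "Suc k \<le> i" "m' \<in> set ms" "p = numbered_monomial L i m'"
      using p by (rule in_set_numbered_polyE)
    then show ?thesis
      using serial_number_unique[of L k m i m'] Cons.prems by (auto simp: admissible_def)
  qed
  then show ?case using Cons by auto
qed simp

lemma wf_numbered_poly:
  assumes "\<forall>m\<in>set ms. admissible L m" "k + length ms \<le> L"
  shows "wf_expanded (2 * L) (numbered_poly L k ms)"
proof -
  have "case p of (c, es) \<Rightarrow> c \<in> {1, 2} \<and> length es = 2 * L \<and> set es \<subseteq> {0, 1, 2}"
    if p: "p \<in> set (numbered_poly L k ms)" for p
  proof -
    obtain i m where "i < k + length ms" "m \<in> set ms" "p = numbered_monomial L i m"
      using p by (rule in_set_numbered_polyE)
    then show ?thesis
      using assms by (fastforce simp: numbered_monomial_def admissible_def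
          dest!: in_set_replicate[THEN iffD1])
  qed
  then show ?thesis
    unfolding wf_expanded_def using distinct_numbered_poly[OF assms(1)] by blast
qed

lemma wf_numbered_system:
  assumes "\<forall>ms\<in>set mss. \<forall>m\<in>set ms. admissible L m" "k + length (concat mss) \<le> L"
  shows "\<forall>p\<in>set (numbered_system L k mss). wf_expanded (2 * L) p"
  using assms
proof (induction mss arbitrary: k)
  case (Cons ms mss)
  then show ?case using Cons.IH[of "k + length ms"] wf_numbered_poly[of ms L k] by simp
qed simp

lemma terms_value_numbered_poly:
  assumes "\<forall>m\<in>set ms. admissible L m" "k + length ms \<le> L" "length a = 2 * L" "set a \<subseteq> {-1, 1}"
  shows "terms_value a (numbered_poly L k ms) = terms_value a ms"
  using assms(1,2)
proof (induction ms arbitrary: k)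
  case (Cons m ms)
  let ?w = "replicate (L - length (snd m)) 0 @ replicate k 2 @ replicate (L - k) (0 :: nat)"
  have "\<forall>e\<in>set ?w. even e" by (auto dest: in_set_replicate[THEN iffD1])
  moreover have "length (snd m @ ?w) \<le> length a"
    using Cons.prems assms(3) by (simp add: admissible_def)
  ultimately have "monomial_value a (numbered_monomial L k m) = monomial_value a m"
    using monomial_value_append_even[of ?w "snd m" a "fst m"] assms(4)
    by (simp add: numbered_monomial_def)
  then show ?case using Cons by simp
qed simp

definition system_value :: "'f::field \<Rightarrow> int list \<Rightarrow> terms list \<Rightarrow> 'f" where
  "system_value \<alpha> a mss = (\<Sum>ms\<leftarrow>mss. \<alpha> ^ nat (terms_value a ms mod 3))"

lemma system_value_numbered_system:
  assumes "\<forall>ms\<in>set mss. \<forall>m\<in>set ms. admissible L m" "k + length (concat mss) \<le> L"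
    and "length a = 2 * L" "set a \<subseteq> {-1, 1}"
  shows "(\<Sum>p\<leftarrow>numbered_system L k mss. \<alpha> ^ nat (eval_expanded p a)) = system_value \<alpha> a mss"
  using assms
  by (induction mss arbitrary: k) (auto simp: system_value_def eval_expanded_eq
      terms_value_numbered_poly)

lemma admissible_gate1_terms:
  assumes "f \<in> {1, 2}" "length (enc_gate1 g) \<le> L" "m \<in> set (gate1_terms f g)"
  shows "admissible L m"
proof (cases g)
  case (Gate1 c es)
  then have "length es \<le> L"
    using assms(2) length_le_length_enc_list[of es] by simp
  then show ?thesis using assms(1,3) Gate1 by (auto simp: admissible_def split: if_splits)
qed

lemma admissible_bits_terms: "f \<in> {1, 2} \<Longrightarrow> m \<in> set (bits_terms f ds) \<Longrightarrow> admissible L m"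
  by (induction f ds rule: bits_terms.induct) (auto simp: digit_terms_def admissible_def
      split: if_splits)

lemma admissible_gate2_terms:
  assumes "f \<in> {1, 2}" "length (enc_gate2 g) \<le> L" "m \<in> set (gate2_terms f g)"
  shows "admissible L m"
proof (cases g)
  case (Gate2 c gs)
  then consider (bits) "m \<in> set (bits_terms f (bits c))"
    | (gate) h where "h \<in> set gs" "m \<in> set (gate1_terms f h)"
    using assms(3) by auto
  then show ?thesis
  proof cases
    case bits
    then show ?thesis using assms(1) by (rule admissible_bits_terms[rotated])
  next
    case gate
    then show ?thesis
      using assms(1,2) Gate2 length_enc_list_member[of h gs enc_gate1]
      by (intro admissible_gate1_terms) simp_all
  qed
qed

lemma length_enc_gate2_le_circuit: "g \<in> set gs \<Longrightarrow>
    length (enc_gate2 g) \<le> length (enc_circuit (Circuit n c gs))"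
  using length_enc_list_member[of g gs enc_gate2] by simp

lemma admissible_reduced_system:
  assumes "ms \<in> set (reduced_system C)" "m \<in> set ms"
  shows "admissible (2 * length (enc_circuit C)) m"
proof (cases C)
  case (Circuit n c gs)
  then obtain f g where "f \<in> {1, 2}" "g \<in> set gs" "m \<in> set (gate2_terms f g)"
    using assms by (auto simp: reduced_system_def gate2_system_def split: if_splits)
  then show ?thesis
    using Circuit length_enc_gate2_le_circuit[of g gs n c]
    by (intro admissible_gate2_terms) simp_all
qed

text \<open>
  Only the common positions count: there are unused signs, and also unused inputs if the
  number of inputs is exponential in the length of the circuit.
\<close>

definition agree :: "nat list \<Rightarrow> int list \<Rightarrow> bool" where
  "agree y a \<longleftrightarrow> (\<forall>i < min (length y) (length a). a ! i = (-1) ^ (y ! i))"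

lemma ex_agreeing_signs: "\<exists>a. length a = N \<and> set a \<subseteq> {-1, 1} \<and> agree y a"
proof (intro exI conjI)
  let ?a = "map (\<lambda>i. if i < length y then (-1) ^ (y ! i) else 1 :: int) [0..<N]"
  show "length ?a = N" "agree y ?a" by (simp_all add: agree_def)
  show "set ?a \<subseteq> {-1, 1}" by (auto simp: minus_one_power_iff)
qed

lemma ex_agreeing_inputs:
  assumes "set a \<subseteq> {-1, 1}"
  shows "\<exists>y. length y = n \<and> set y \<subseteq> {0, 1} \<and> agree y a"
proof (intro exI conjI)
  let ?y = "map (\<lambda>i. if i < length a \<and> a ! i = -1 then 1 else 0 :: nat) [0..<n]"
  show "length ?y = n" "set ?y \<subseteq> {0, 1}" by auto
  have "a ! i \<in> {-1, 1}" if "i < length a" for i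
    using that assms nth_mem by blast
  then show "agree ?y a" by (auto simp: agree_def)
qed

lemma cong_gate1_terms:
  assumes f: "f \<in> {1, 2}" and "agree y a" and es: "wf_gate1 (length y) g"
    "length (enc_gate1 g) \<le> length a"
  shows "[terms_value a (gate1_terms f g) = int (f * eval_gate1 y g)] (mod 3)"
proof -
  obtain c es where g: "g = Gate1 c es" by (cases g)
  have "length es = length y" "length es \<le> length a"
    using es length_le_length_enc_list[of es] by (simp_all add: g)
  then have sign: "a ! i = (-1) ^ (y ! i)" if "i < length es" for i
    using assms(2) that by (simp add: agree_def)
  let ?z = "\<Sum>i<length es. es ! i * y ! i"
  have power_mod_2: "((-1) ^ j) ^ (e mod 2) = (-1 :: int) ^ (e * j)" for e j :: nat
    by (cases "even e") (simp_all add: minus_one_power_iff odd_iff_mod_2_eq_one)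
  have "(\<Prod>i<length es. a ! i ^ (es ! i mod 2)) = (\<Prod>i<length es. (-1) ^ (es ! i * y ! i))"
    using sign power_mod_2 by (intro prod.cong) simp_all
  also have "\<dots> = (-1) ^ ?z"
    by (simp add: power_sum)
  finally have "(\<Prod>i<length es. a ! i ^ (es ! i mod 2)) = (if even ?z then 1 else -1)"
    by (simp add: minus_one_power_iff)
  then show ?thesis
    using f by (cases "even c"; cases "even ?z") (auto simp: g monomial_value_def Mod_def cong_def)
qed

lemma cong_negate_double:
  assumes "f \<in> {1, 2}"
  shows "[int ((3 - f) * n) = int (f * (2 * n))] (mod 3)"
proof -
  have "[int n = 4 * int n] (mod 3)" by (simp add: cong_iff_dvd_diff)
  then show ?thesis using assms by auto
qed

lemma cong_bits_terms: "f \<in> {1, 2} \<Longrightarrow> [terms_value a (bits_terms f (bits n)) = int (f * n)] (mod 3)"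
proof (induction n arbitrary: f rule: nat_bit_induct)
  case zero
  then show ?case by simp
next
  case (even n)
  have "[terms_value a (bits_terms (3 - f) (bits n)) = int ((3 - f) * n)] (mod 3)"
    by (rule even.IH) (use even.prems in auto)
  from cong_trans[OF this cong_negate_double[OF even.prems]] show ?case
    by (simp add: bits_double[OF even.hyps] digit_terms_def)
next
  case (odd n)
  have "[terms_value a (bits_terms (3 - f) (bits n)) = int ((3 - f) * n)] (mod 3)"
    by (rule odd.IH) (use odd.prems in auto)
  from cong_add[OF cong_refl[of "int f"] cong_trans[OF this cong_negate_double[OF odd.prems]]]
  show ?case
    by (simp add: bits_double_Suc digit_terms_def monomial_value_def distrib_left)
qed

lemma cong_gate2_terms:
  assumes f: "f \<in> {1, 2}" and "agree y a" and "wf_gate2 (length y) (Gate2 c gs)"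
    and "length (enc_gate2 (Gate2 c gs)) \<le> length a"
  shows "[terms_value a (gate2_terms f (Gate2 c gs)) = int (f * (c + (\<Sum>g\<leftarrow>gs. eval_gate1 y g)))]
      (mod 3)"
proof -
  have "[terms_value a (gate1_terms f g) = int (f * eval_gate1 y g)] (mod 3)" if "g \<in> set gs" for g
    using assms that length_enc_list_member[of g gs enc_gate1] by (intro cong_gate1_terms) auto
  then have "[terms_value a (concat (map (gate1_terms f) gs)) = int (f * (\<Sum>g\<leftarrow>gs. eval_gate1 y g))]
      (mod 3)"
    by (induction gs) (auto simp: distrib_left intro: cong_add)
  from cong_add[OF cong_bits_terms[OF f] this] show ?thesis
    by (simp add: distrib_left)
qed

lemma of_nat_char_two: "(2 :: 'a::semiring_1) = 0 \<Longrightarrow> of_nat n = (if even n then 0 else 1 :: 'a)"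
  by (induction n) simp_all

lemma Mod_3_eq_power_sum:
  fixes \<alpha> :: "'f::field"
  assumes char: "(2 :: 'f) = 0" and root: "1 + \<alpha> + \<alpha>\<^sup>2 = 0"
    and v: "[v = int z] (mod 3)" and w: "[w = int (2 * z)] (mod 3)"
  shows "1 + \<alpha> ^ nat (v mod 3) + \<alpha> ^ nat (w mod 3) = of_nat (Mod 3 z)"
proof -
  have "nat (int x mod 3) = x mod 3" for x
    using nat_mod_distrib[of "int x" 3] by simp
  then have exponents: "nat (v mod 3) = z mod 3" "nat (w mod 3) = 2 * z mod 3"
    using v w by (simp_all only: cong_def)
  have "z mod 3 = 0 \<or> z mod 3 = 1 \<or> z mod 3 = 2"
    by presburger
  then show ?thesis
  proof (elim disjE)
    assume z: "z mod 3 = 0"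
    then have "2 * z mod 3 = 0" by presburger
    moreover have "1 + 1 + 1 = (1 :: 'f)" using char by (simp only: one_add_one add_0)
    ultimately show ?thesis by (simp only: exponents z Mod_def dvd_eq_mod_eq_0 power_0) simp
  next
    assume z: "z mod 3 = 1"
    then have "2 * z mod 3 = 2" by presburger
    then show ?thesis using root by (simp only: exponents z Mod_def dvd_eq_mod_eq_0) simp
  next
    assume z: "z mod 3 = 2"
    then have "2 * z mod 3 = 1" by presburger
    moreover have "1 + \<alpha>\<^sup>2 + \<alpha> = 0" using root by (simp only: add_ac)
    ultimately show ?thesis by (simp only: exponents z Mod_def dvd_eq_mod_eq_0) simp
  qed
qed

lemma system_value_reduced_system:
  assumes two: "(2 :: 'f::field) = 0" and root: "1 + \<alpha> + \<alpha>\<^sup>2 = (0 :: 'f)"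
    and "wf_circuit (Circuit n c gs)" "length (enc_circuit (Circuit n c gs)) \<le> length a"
    and "length y = n" "agree y a"
  shows "system_value \<alpha> a (reduced_system (Circuit n c gs)) = of_nat (c + (\<Sum>g\<leftarrow>gs. eval_gate2 y g))"
proof -
  let ?e = "\<lambda>ms. \<alpha> ^ nat (terms_value a ms mod 3)"
  have gate: "1 + ?e (gate2_terms 1 g) + ?e (gate2_terms 2 g) = of_nat (eval_gate2 y g)"
      if "g \<in> set gs" for g
  proof -
    obtain c' hs where g: "g = Gate2 c' hs" by (cases g)
    let ?z = "c' + (\<Sum>h\<leftarrow>hs. eval_gate1 y h)"
    have "[terms_value a (gate2_terms f g) = int (f * ?z)] (mod 3)" if "f \<in> {1, 2}" for f
      unfolding g using assms \<open>g \<in> set gs\<close> that length_enc_gate2_le_circuit[of g gs n c]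
      by (intro cong_gate2_terms) (auto simp: g)
    from this[of 1] this[of 2] show ?thesis
      using Mod_3_eq_power_sum[OF two root] by (simp add: g)
  qed
  have "system_value \<alpha> a (reduced_system (Circuit n c gs)) =
      of_nat c + (\<Sum>g\<leftarrow>gs. 1 + ?e (gate2_terms 1 g) + ?e (gate2_terms 2 g))"
    by (induction gs) (simp_all add: system_value_def reduced_system_def gate2_system_def
        of_nat_char_two[OF two] add_ac)
  also have "\<dots> = of_nat c + (\<Sum>g\<leftarrow>gs. of_nat (eval_gate2 y g))"
    using gate by (simp cong: map_cong)
  also have "\<dots> = of_nat (c + (\<Sum>g\<leftarrow>gs. eval_gate2 y g))"
    by (induction gs) (simp_all add: add_ac)
  finally show ?thesis .
qed

lemma reduction_in_instances: "reduction C \<in> instances (poly_exp_sum_zero \<alpha>)"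
  using wf_numbered_system[of "reduced_system C" "2 * length (enc_circuit C)" 0]
    admissible_reduced_system length_reduced_system[of C]
  by (auto simp: poly_exp_sum_zero_def reduction_def Let_def)

lemma holds_reduction_iff:
  fixes \<alpha> :: "'f::field"
  shows "holds (poly_exp_sum_zero \<alpha>) (reduction C) \<longleftrightarrow>
    (\<forall>a. length a = 4 * length (enc_circuit C) \<and> set a \<subseteq> {-1, 1} \<longrightarrow>
      system_value \<alpha> a (reduced_system C) = 0)"
proof -
  let ?N = "length (enc_circuit C)"
  have "(\<Sum>p\<leftarrow>numbered_system (2 * ?N) 0 (reduced_system C). \<alpha> ^ nat (eval_expanded p a)) =
      system_value \<alpha> a (reduced_system C)" if "length a = 4 * ?N" "set a \<subseteq> {-1, 1}" for a
    by (rule system_value_numbered_system)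
       (use that admissible_reduced_system length_reduced_system[of C]
        in \<open>simp_all del: insert_iff\<close>)
  then show ?thesis
    by (simp add: poly_exp_sum_zero_def reduction_def Let_def cong: conj_cong imp_cong)
qed

lemma reduction_correct:
  assumes two: "(2 :: 'f::field) = 0" and root: "1 + \<alpha> + \<alpha>\<^sup>2 = (0 :: 'f)" and wf: "wf_circuit C"
  shows "holds cc232_equivalence C \<longleftrightarrow> holds (poly_exp_sum_zero \<alpha>) (reduction C)"
proof -
  obtain n c gs where C: "C = Circuit n c gs" by (cases C)
  have eval: "system_value \<alpha> a (reduced_system C) = 0 \<longleftrightarrow> eval_circuit y C = 1"
    if "length a = 4 * length (enc_circuit C)" "length y = n" "agree y a" for a y
  proof -
    have "system_value \<alpha> a (reduced_system C) = of_nat (c + (\<Sum>g\<leftarrow>gs. eval_gate2 y g))"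
      using wf that unfolding C by (intro system_value_reduced_system[OF two root]) simp_all
    then show ?thesis
      by (simp add: C Mod_def of_nat_char_two[OF two] del: of_nat_add)
  qed
  have "(\<forall>y. length y = n \<and> set y \<subseteq> {0, 1} \<longrightarrow> eval_circuit y C = 1) \<longleftrightarrow>
      (\<forall>a. length a = 4 * length (enc_circuit C) \<and> set a \<subseteq> {-1, 1} \<longrightarrow>
        system_value \<alpha> a (reduced_system C) = 0)"
  proof (intro iffI allI impI; elim conjE)
    fix a :: "int list" assume a: "length a = 4 * length (enc_circuit C)" "set a \<subseteq> {-1, 1}"
    assume "\<forall>y. length y = n \<and> set y \<subseteq> {0, 1} \<longrightarrow> eval_circuit y C = 1"
    moreover obtain y where "length y = n" "set y \<subseteq> {0, 1}" "agree y a"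
      using ex_agreeing_inputs[OF a(2)] by blast
    ultimately show "system_value \<alpha> a (reduced_system C) = 0"
      using eval[OF a(1)] by blast
  next
    fix y :: "nat list" assume y: "length y = n"
    assume "\<forall>a. length a = 4 * length (enc_circuit C) \<and> set a \<subseteq> {-1, 1} \<longrightarrow>
        system_value \<alpha> a (reduced_system C) = 0"
    moreover obtain a where "length a = 4 * length (enc_circuit C)" "set a \<subseteq> {-1, 1}" "agree y a"
      using ex_agreeing_signs by blast
    ultimately show "eval_circuit y C = 1"
      using eval[OF _ y] by blast
  qed
  then show ?thesis
    unfolding holds_reduction_iff by (simp add: cc232_equivalence_def C)
qed

lemma polytime_transformation_reduction:
  "polytime_transformation cc232_equivalence (poly_exp_sum_zero \<alpha>) reduction"
  unfolding polytime_transformation_def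
proof (intro conjI exI ballI)
  show "wf_tm (machine 4 6 reduction_com)"
    by (rule wf_machine[OF wf_reduction_com]) simp_all
  show "computes_within (machine 4 6 reduction_com) (encode cc232_equivalence C)
      (encode (poly_exp_sum_zero \<alpha>) (reduction C))
      (poly [:57, 504, 432:] (length (encode cc232_equivalence C)))" for C
    using reduction_computable by (simp add: cc232_equivalence_def poly_exp_sum_zero_def)
qed (rule reduction_in_instances)

section \<open>The field with four elements\<close>

lemma of_nat_card_UNIV:
  assumes "finite (UNIV :: 'a::ring_1 set)"
  shows "of_nat (card (UNIV :: 'a set)) = (0 :: 'a)"
proof -
  have "bij_betw (\<lambda>x :: 'a. x + 1) UNIV UNIV"
    by (rule bij_betw_byWitness[where f' = "\<lambda>x. x - 1"]) auto
  then have "(\<Sum>x\<in>UNIV. x + 1) = (\<Sum>x\<in>UNIV. x :: 'a)"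
    by (rule sum.reindex_bij_betw)
  then show ?thesis
    using assms by (simp add: sum.distrib)
qed

lemma power_card_minus_1:
  fixes x :: "'f::field"
  assumes "finite (UNIV :: 'f set)" and "x \<noteq> 0"
  shows "x ^ (card (UNIV :: 'f set) - 1) = 1"
proof -
  have "bij_betw (\<lambda>y. x * y) (UNIV - {0}) (UNIV - {0})"
    by (rule bij_betw_byWitness[where f' = "\<lambda>y. y / x"]) (use assms(2) in auto)
  then have "(\<Prod>y\<in>UNIV - {0}. x * y) = (\<Prod>y\<in>UNIV - {0}. y)"
    by (rule prod.reindex_bij_betw)
  moreover have "(\<Prod>y\<in>UNIV - {0 :: 'f}. y) \<noteq> 0" using assms(1) by simp
  ultimately show ?thesis using assms(1) by (simp add: prod.distrib)
qed

lemma primitive_element_nonzero: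
  assumes "primitive_element \<alpha>"
  shows "\<alpha> \<noteq> 0"
proof -
  have "\<alpha> ^ 1 \<in> UNIV - {0}"
    using assms unfolding primitive_element_def by blast
  then show ?thesis by simp
qed

lemma primitive_element_neq_1:
  assumes "primitive_element (\<alpha> :: 'f::field)" "card (UNIV :: 'f set) > 2"
  shows "\<alpha> \<noteq> 1"
proof
  assume "\<alpha> = 1"
  then have "UNIV - {0} = {1 :: 'f}" using assms(1) by (simp add: primitive_element_def)
  then have "(UNIV :: 'f set) = {0, 1}" by blast
  then have "card (UNIV :: 'f set) = card {0, 1 :: 'f}" by (rule arg_cong)
  then show False using assms(2) by simp
qed

lemma two_eq_0_if_card_4:
  assumes "card (UNIV :: 'f::field set) = 4"
  shows "(2 :: 'f) = 0"
proof -
  have "finite (UNIV :: 'f set)" using assms by (intro card_ge_0_finite) simp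
  then have "(2 :: 'f) * 2 = 0" using of_nat_card_UNIV assms by fastforce
  then show ?thesis using mult_eq_0_iff by blast
qed

lemma primitive_element_root:
  fixes \<alpha> :: "'f::field"
  assumes "card (UNIV :: 'f set) = 4" "primitive_element \<alpha>"
  shows "1 + \<alpha> + \<alpha>\<^sup>2 = 0"
proof -
  have "finite (UNIV :: 'f set)" using assms(1) by (intro card_ge_0_finite) simp
  then have "\<alpha> ^ 3 = 1"
    using power_card_minus_1[of \<alpha>] primitive_element_nonzero[OF assms(2)] assms(1) by simp
  moreover have "(\<alpha> - 1) * (1 + \<alpha> + \<alpha>\<^sup>2) = \<alpha> ^ 3 - 1"
    by (simp add: algebra_simps power2_eq_square power3_eq_cube)
  ultimately show ?thesis
    using primitive_element_neq_1[OF assms(2)] assms(1) by simp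
qed

theorem theorem7p3:
  fixes \<alpha> :: "'f::field"
  assumes "card (UNIV :: 'f set) = 4"
    and "primitive_element \<alpha>"
  shows "polytime_reducible cc232_equivalence (poly_exp_sum_zero \<alpha>)"
  unfolding polytime_reducible_def
proof (intro exI conjI ballI)
  show "polytime_transformation cc232_equivalence (poly_exp_sum_zero \<alpha>) reduction"
    by (rule polytime_transformation_reduction)
  fix C assume "C \<in> instances cc232_equivalence"
  then have "wf_circuit C" by (simp add: cc232_equivalence_def)
  with two_eq_0_if_card_4[OF assms(1)] primitive_element_root[OF assms]
  show "holds cc232_equivalence C \<longleftrightarrow> holds (poly_exp_sum_zero \<alpha>) (reduction C)"
    by (rule reduction_correct)
qed

end
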